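(* Let $n \geq 3$ be an integer. For $\mathbf{a} = (a_1, \ldots, a_{n-1}) \in \mathbb{N}^{n-1}$ with $a_i \geq 2$ for all $i$, and for an integer $d \geq 3$, consider the proper polynomial map $f_{d,\mathbf{a}} \colon \mathbb{C}^n \longrightarrow \mathbb{C}^n$ defined by $$f_{d,\mathbf{a}}(x_1, \ldots, x_n) := \bigl(x_1,\, x_2, \ldots, x_{n-1},\, x_n^d - d\,(x_1^{a_1} + x_2^{a_2} + \cdots + x_{n-1}^{a_{n-1}})\,x_n\bigr).$$ Let $d \geq 3$ and let $\mathbf{a} = (a_1,\ldots,a_{n-1})$, $\mathbf{b} = (b_1,\ldots,b_{n-1}) \in \mathbb{N}^{n-1}$ with $a_i \geq 2$ and $b_i \geq 2$ for all $i$. If $\prod_{i=1}^{n-1}(a_i - 1) \neq \prod_{i=1}^{n-1}(b_i - 1)$, then $f_{d,\mathbf{a}}$ and $f_{d,\mathbf{b}}$ are not equivalent. It follows that for all $d \geq 3$ there exist infinitely many different equivalence classes of proper polynomial maps $f \colon \mathbb{C}^n \longrightarrow \mathbb{C}^n$ of topological degree $d$.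
   Context: A dominant polynomial map $f \colon \mathbb{C}^n \longrightarrow \mathbb{C}^n$ is called proper if for every compact set $K \subset \mathbb{C}^n$ the set $f^{-1}(K)$ is compact. For a proper polynomial map $f$, let $J_f$ be the determinant of its Jacobian matrix, let $\mathrm{Crit}(f) = V(J_f)$ be the critical locus (the zero set of $J_f$), and let $B(f) = f(\mathrm{Crit}(f))$ be the branch locus; the restriction $f \colon \mathbb{C}^n \setminus f^{-1}(B(f)) \longrightarrow \mathbb{C}^n \setminus B(f)$ is an unramified covering of finite degree, called the topological degree of $f$. $\mathrm{Aut}(\mathbb{C}^n)$ denotes the group of polynomial automorphisms of $\mathbb{C}^n$ (polynomial maps with polynomial inverse). Two proper polynomial maps $f_1, f_2 \colon \mathbb{C}^n \longrightarrow \mathbb{C}^n$ are called equivalent if there exist $\Phi_1, \Phi_2 \in \mathrm{Aut}(\mathbb{C}^n)$ such that $f_2 = \Phi_2 \circ f_1 \circ \Phi_1$. *)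

theory Defs
  imports "HOL-Analysis.Analysis"
begin

definition polynomial_fun :: "(complex ^ 'n \<Rightarrow> complex) \<Rightarrow> bool" where
  "polynomial_fun p \<longleftrightarrow>
     (\<exists>(A :: ('n \<Rightarrow> nat) set) c. finite A \<and>
        (\<forall>x. p x = (\<Sum>\<alpha>\<in>A. c \<alpha> * (\<Prod>i\<in>UNIV. (x $ i) ^ \<alpha> i))))"

definition polynomial_map :: "(complex ^ 'n \<Rightarrow> complex ^ 'm) \<Rightarrow> bool" where
  "polynomial_map f \<longleftrightarrow> (\<forall>i. polynomial_fun (\<lambda>x. f x $ i))"

text \<open>Dominant means that the image is Zariski dense, i.e. the zero polynomial
  is the only polynomial vanishing on it.\<close>

definition dominant :: "(complex ^ 'n \<Rightarrow> complex ^ 'm) \<Rightarrow> bool" where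
  "dominant f \<longleftrightarrow>
     (\<forall>p. polynomial_fun p \<and> (\<forall>x. p (f x) = 0) \<longrightarrow> (\<forall>y. p y = 0))"

definition proper_polynomial_map :: "(complex ^ 'n \<Rightarrow> complex ^ 'n) \<Rightarrow> bool" where
  "proper_polynomial_map f \<longleftrightarrow>
     polynomial_map f \<and> dominant f \<and> (\<forall>K. compact K \<longrightarrow> compact (f -` K))"

text \<open>The entries of the Jacobian matrix are the complex partial derivatives: entry
  \<open>(i, j)\<close> is the derivative of the \<open>i\<close>-th component along the \<open>j\<close>-th coordinate line.\<close>

definition jacobian_matrix :: "(complex ^ 'n \<Rightarrow> complex ^ 'n) \<Rightarrow> complex ^ 'n \<Rightarrow> complex ^ 'n ^ 'n" where
  "jacobian_matrix f x = (\<chi> i j. deriv (\<lambda>t. f (x + axis j t) $ i) 0)"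

definition jacobian_det :: "(complex ^ 'n \<Rightarrow> complex ^ 'n) \<Rightarrow> complex ^ 'n \<Rightarrow> complex" where
  "jacobian_det f x = det (jacobian_matrix f x)"

definition critical_locus :: "(complex ^ 'n \<Rightarrow> complex ^ 'n) \<Rightarrow> (complex ^ 'n) set" where
  "critical_locus f = {x. jacobian_det f x = 0}"

definition branch_locus :: "(complex ^ 'n \<Rightarrow> complex ^ 'n) \<Rightarrow> (complex ^ 'n) set" where
  "branch_locus f = f ` critical_locus f"

text \<open>The restriction of \<open>f\<close> over the complement of the branch locus is a covering with
  \<open>k\<close> sheets. The fibre over a point outside the branch locus lies entirely in the total
  space of this covering. The branch locus is required not to be everything, since
  otherwise the condition would hold vacuously for every \<open>k\<close>.\<close>

definition has_topological_degree :: "(complex ^ 'n \<Rightarrow> complex ^ 'n) \<Rightarrow> nat \<Rightarrow> bool" where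
  "has_topological_degree f k \<longleftrightarrow>
     branch_locus f \<noteq> UNIV \<and>
     covering_space (- (f -` branch_locus f)) f (- branch_locus f) \<and>
     (\<forall>y. y \<notin> branch_locus f \<longrightarrow> finite (f -` {y}) \<and> card (f -` {y}) = k)"

definition polynomial_automorphism :: "(complex ^ 'n \<Rightarrow> complex ^ 'n) \<Rightarrow> bool" where
  "polynomial_automorphism \<Phi> \<longleftrightarrow>
     polynomial_map \<Phi> \<and> (\<exists>\<Psi>. polynomial_map \<Psi> \<and> \<Psi> \<circ> \<Phi> = id \<and> \<Phi> \<circ> \<Psi> = id)"

definition equivalent_maps ::
    "(complex ^ 'n \<Rightarrow> complex ^ 'n) \<Rightarrow> (complex ^ 'n \<Rightarrow> complex ^ 'n) \<Rightarrow> bool" where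
  "equivalent_maps f1 f2 \<longleftrightarrow>
     (\<exists>\<Phi>1 \<Phi>2. polynomial_automorphism \<Phi>1 \<and> polynomial_automorphism \<Phi>2 \<and> f2 = \<Phi>2 \<circ> f1 \<circ> \<Phi>1)"

definition proper_equivalence ::
    "((complex ^ 'n \<Rightarrow> complex ^ 'n) \<times> (complex ^ 'n \<Rightarrow> complex ^ 'n)) set" where
  "proper_equivalence =
     {(f1, f2). proper_polynomial_map f1 \<and> proper_polynomial_map f2 \<and> equivalent_maps f1 f2}"

text \<open>Coordinates are indexed by a finite type with \<open>n\<close> elements, and the index \<open>l\<close> plays the
  role of the last one. The exponents are given by a function on all indices whose value at \<open>l\<close>
  is never used.\<close>

definition f_map :: "'n \<Rightarrow> nat \<Rightarrow> ('n \<Rightarrow> nat) \<Rightarrow> complex ^ 'n \<Rightarrow> complex ^ 'n" where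
  "f_map l d a x =
     (\<chi> i. if i = l
           then (x $ l) ^ d - of_nat d * (\<Sum>j\<in>UNIV - {l}. (x $ j) ^ a j) * x $ l
           else x $ i)"

end

theory Submission
  imports Defs "HOL-Computational_Algebra.Fundamental_Theorem_Algebra"
begin

text \<open>If \<open>f\<^sub>2 = \<Phi>\<^sub>2 \<circ> f\<^sub>1 \<circ> \<Phi>\<^sub>1\<close>, the chain rule gives \<open>J\<^sub>2 = w \<cdot> (J\<^sub>1 \<circ> \<Phi>\<^sub>1)\<close> for the Jacobian
  determinants, with \<open>w\<close> polynomial, so composition with the inverse of \<open>\<Phi>\<^sub>1\<close> induces a surjection
  of the Tjurina algebra of \<open>J\<^sub>2\<close> (the polynomial ring modulo the function and all its partial
  derivatives) onto that of \<open>J\<^sub>1\<close>, and by symmetry their dimensions agree. For the map \<open>f\<close> with parameters \<open>d\<close> and \<open>a\<close> the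
  determinant is \<open>d (x\<^sub>n\<^sup>d\<^sup>-\<^sup>1 - \<Sum> x\<^sub>i\<^bsup>a\<^sub>i\<^esup>)\<close>; it is weighted homogeneous, so its Tjurina ideal is the
  monomial ideal generated by the partial derivatives \<open>x\<^sub>n\<^sup>d\<^sup>-\<^sup>2\<close> and \<open>x\<^sub>i\<^bsup>a\<^sub>i-1\<^esup>\<close>, of codimension
  \<open>(d - 2) \<Prod> (a\<^sub>i - 1)\<close>. As \<open>d \<ge> 3\<close>, the product is an invariant.

  Outside the branch locus the \<open>d\<close> roots of the last coordinate equation are simple, hence the
  fibres have constant size \<open>d\<close>, and a locally injective map with constant finite fibre size is
  a covering by invariance of domain.\<close>

subsection \<open>Polynomial functions\<close>

definition monomial_fun :: "('n::finite \<Rightarrow> nat) \<Rightarrow> complex ^ 'n \<Rightarrow> complex" where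
  "monomial_fun \<alpha> x = (\<Prod>i\<in>UNIV. (x $ i) ^ \<alpha> i)"

text \<open>Recording which exponents may occur turns membership in a monomial ideal into a
  condition on supports, to which the independence of monomials applies.\<close>

definition supported_poly :: "('n::finite \<Rightarrow> nat) set \<Rightarrow> (complex ^ 'n \<Rightarrow> complex) \<Rightarrow> bool" where
  "supported_poly S p \<longleftrightarrow>
     (\<exists>A c. finite A \<and> A \<subseteq> S \<and> (\<forall>x. p x = (\<Sum>\<alpha>\<in>A. c \<alpha> * monomial_fun \<alpha> x)))"

lemma polynomial_fun_iff: "polynomial_fun p \<longleftrightarrow> supported_poly UNIV p"
  by (simp add: polynomial_fun_def supported_poly_def monomial_fun_def)

lemma monomial_fun_mult:
  "monomial_fun \<alpha> x * monomial_fun \<beta> x = monomial_fun (\<lambda>i. \<alpha> i + \<beta> i) x"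
  by (simp add: monomial_fun_def prod.distrib power_add)

lemma monomial_fun_mult_vec:
  "monomial_fun \<alpha> (\<chi> i. x $ i * y $ i) = monomial_fun \<alpha> x * monomial_fun \<alpha> y"
  by (simp add: monomial_fun_def power_mult_distrib prod.distrib)

lemma monomial_fun_single: "monomial_fun (\<lambda>j. if j = i then k else 0) x = (x $ i) ^ k"
proof -
  have "monomial_fun (\<lambda>j. if j = i then k else 0) x = (\<Prod>j\<in>UNIV. if j = i then (x $ j) ^ k else 1)"
    unfolding monomial_fun_def by (rule prod.cong) auto
  then show ?thesis by simp
qed

text \<open>The map \<open>h\<close> may repeat exponents, since coefficients over each of its
  fibres are added up. Sums and products can then be indexed by \<open>A <+> B\<close> and
  \<open>A \<times> B\<close> without regard to coinciding monomials.\<close>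

lemma supported_poly_sum_monomials:
  assumes "finite K" "\<And>k. k \<in> K \<Longrightarrow> h k \<in> S"
  shows "supported_poly S (\<lambda>x. \<Sum>k\<in>K. c k * monomial_fun (h k) x)"
proof -
  have "(\<Sum>k\<in>K. c k * monomial_fun (h k) x)
      = (\<Sum>\<alpha>\<in>h ` K. (\<Sum>k | k \<in> K \<and> h k = \<alpha>. c k) * monomial_fun \<alpha> x)" for x
    by (subst sum.image_gen[OF assms(1), where g = h]) (simp add: sum_distrib_right)
  then show ?thesis
    unfolding supported_poly_def using assms
    by (intro exI[of _ "h ` K"] exI[of _ "\<lambda>\<alpha>. \<Sum>k | k \<in> K \<and> h k = \<alpha>. c k"]) auto
qed

lemma supported_poly_add:
  assumes "supported_poly S p" "supported_poly S q"
  shows "supported_poly S (\<lambda>x. p x + q x)"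
proof -
  obtain A c where A: "finite A" "A \<subseteq> S" "\<And>x. p x = (\<Sum>\<alpha>\<in>A. c \<alpha> * monomial_fun \<alpha> x)"
    using assms(1) unfolding supported_poly_def by blast
  obtain B e where B: "finite B" "B \<subseteq> S" "\<And>x. q x = (\<Sum>\<alpha>\<in>B. e \<alpha> * monomial_fun \<alpha> x)"
    using assms(2) unfolding supported_poly_def by blast
  have "p x + q x = (\<Sum>k\<in>A <+> B. case_sum c e k * monomial_fun (case_sum id id k) x)" for x
    using A B by (simp add: sum.Plus)
  moreover have "supported_poly S
      (\<lambda>x. \<Sum>k\<in>A <+> B. case_sum c e k * monomial_fun (case_sum id id k) x)"
    using A B by (intro supported_poly_sum_monomials) auto
  ultimately show ?thesis by simp
qed

lemma supported_poly_mult: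
  assumes "supported_poly S p" "supported_poly T q"
    and "\<And>\<alpha> \<beta>. \<alpha> \<in> S \<Longrightarrow> \<beta> \<in> T \<Longrightarrow> (\<lambda>i. \<alpha> i + \<beta> i) \<in> U"
  shows "supported_poly U (\<lambda>x. p x * q x)"
proof -
  obtain A c where A: "finite A" "A \<subseteq> S" "\<And>x. p x = (\<Sum>\<alpha>\<in>A. c \<alpha> * monomial_fun \<alpha> x)"
    using assms(1) unfolding supported_poly_def by blast
  obtain B e where B: "finite B" "B \<subseteq> T" "\<And>x. q x = (\<Sum>\<alpha>\<in>B. e \<alpha> * monomial_fun \<alpha> x)"
    using assms(2) unfolding supported_poly_def by blast
  have "p x * q x = (\<Sum>k\<in>A \<times> B. (c (fst k) * e (snd k)) *
      monomial_fun (\<lambda>i. fst k i + snd k i) x)" for x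
    unfolding A B sum_product sum.cartesian_product
    by (rule sum.cong) (auto simp: monomial_fun_mult[symmetric])
  moreover have "supported_poly U (\<lambda>x. \<Sum>k\<in>A \<times> B. (c (fst k) * e (snd k)) *
      monomial_fun (\<lambda>i. fst k i + snd k i) x)"
    using A B assms(3) by (intro supported_poly_sum_monomials) (auto simp: subset_iff)
  ultimately show ?thesis by simp
qed

lemma supported_poly_monomial: "\<alpha> \<in> S \<Longrightarrow> supported_poly S (monomial_fun \<alpha>)"
  unfolding supported_poly_def by (intro exI[of _ "{\<alpha>}"] exI[of _ "\<lambda>_. 1"]) auto

lemma supported_poly_zero: "supported_poly S (\<lambda>x. 0)"
  unfolding supported_poly_def by (intro exI[of _ "{}"]) auto

lemma supported_poly_sum:
  "(\<And>i. i \<in> I \<Longrightarrow> supported_poly S (p i)) \<Longrightarrow> supported_poly S (\<lambda>x. \<Sum>i\<in>I. p i x)"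
  by (induction I rule: infinite_finite_induct) (auto simp: supported_poly_add supported_poly_zero)

lemma polynomial_fun_add:
  "polynomial_fun p \<Longrightarrow> polynomial_fun q \<Longrightarrow> polynomial_fun (\<lambda>x. p x + q x)"
  by (simp add: polynomial_fun_iff supported_poly_add)

lemma polynomial_fun_mult:
  "polynomial_fun p \<Longrightarrow> polynomial_fun q \<Longrightarrow> polynomial_fun (\<lambda>x. p x * q x)"
  unfolding polynomial_fun_iff by (rule supported_poly_mult) auto

lemma polynomial_fun_const: "polynomial_fun (\<lambda>x. c)"
proof -
  have "monomial_fun (\<lambda>_. 0) x = 1" for x by (simp add: monomial_fun_def)
  then show ?thesis
    unfolding polynomial_fun_iff supported_poly_def
    by (intro exI[of _ "{\<lambda>_. 0}"] exI[of _ "\<lambda>_. c"]) auto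
qed

lemma polynomial_fun_coord: "polynomial_fun (\<lambda>x. x $ i)"
  using supported_poly_monomial[of "\<lambda>j. if j = i then 1 else 0" UNIV]
  by (simp add: polynomial_fun_iff monomial_fun_single[abs_def])

lemma polynomial_fun_sum:
  "(\<And>i. i \<in> I \<Longrightarrow> polynomial_fun (p i)) \<Longrightarrow> polynomial_fun (\<lambda>x. \<Sum>i\<in>I. p i x)"
  by (simp add: polynomial_fun_iff supported_poly_sum)

lemma polynomial_fun_prod:
  "(\<And>i. i \<in> I \<Longrightarrow> polynomial_fun (p i)) \<Longrightarrow> polynomial_fun (\<lambda>x. \<Prod>i\<in>I. p i x)"
  by (induction I rule: infinite_finite_induct) (auto simp: polynomial_fun_mult polynomial_fun_const)

lemma polynomial_fun_power: "polynomial_fun p \<Longrightarrow> polynomial_fun (\<lambda>x. p x ^ k)"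
  by (induction k) (auto simp: polynomial_fun_mult polynomial_fun_const)

lemma polynomial_fun_diff:
  assumes "polynomial_fun p" "polynomial_fun q"
  shows "polynomial_fun (\<lambda>x. p x - q x)"
  using polynomial_fun_add[OF assms(1) polynomial_fun_mult[OF polynomial_fun_const[of "-1"] assms(2)]]
  by simp

lemmas polynomial_fun_intros =
  polynomial_fun_add polynomial_fun_mult polynomial_fun_const polynomial_fun_coord
  polynomial_fun_sum polynomial_fun_prod polynomial_fun_power polynomial_fun_diff

lemma polynomial_fun_monomial: "polynomial_fun (monomial_fun \<alpha>)"
  by (simp add: polynomial_fun_iff supported_poly_monomial)

text \<open>Structural induction for statements about derivatives and compositions. The inductive
  cases also supply polynomiality of both operands, which the product rule for
  \<open>partial\<close> asks for.\<close>

lemma polynomial_fun_induct [consumes 1, case_names const coord add mult]: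
  assumes "polynomial_fun p"
    and const: "\<And>c. P (\<lambda>x. c)" and coord: "\<And>i. P (\<lambda>x. x $ i)"
    and add: "\<And>p q. polynomial_fun p \<Longrightarrow> polynomial_fun q \<Longrightarrow> P p \<Longrightarrow> P q \<Longrightarrow> P (\<lambda>x. p x + q x)"
    and mult: "\<And>p q. polynomial_fun p \<Longrightarrow> polynomial_fun q \<Longrightarrow> P p \<Longrightarrow> P q \<Longrightarrow> P (\<lambda>x. p x * q x)"
  shows "P p"
proof -
  obtain A c where A: "finite A"
    and p: "p = (\<lambda>x. \<Sum>\<alpha>\<in>A. c \<alpha> * (\<Prod>i\<in>UNIV. (x $ i) ^ \<alpha> i))"
    using assms(1) unfolding polynomial_fun_def by blast
  have pow: "P (\<lambda>x. (x $ i) ^ k)" for i k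
  proof (induction k)
    case (Suc k)
    then have "P (\<lambda>x. x $ i * (x $ i) ^ k)"
      by (intro mult coord polynomial_fun_intros)
    then show ?case by simp
  qed (simp add: const)
  have "P (\<lambda>x. \<Prod>i\<in>I. (x $ i) ^ \<alpha> i)" for I and \<alpha> :: "'a \<Rightarrow> nat"
  proof (induction I rule: infinite_finite_induct)
    case (insert i I)
    then have "P (\<lambda>x. (x $ i) ^ \<alpha> i * (\<Prod>i\<in>I. (x $ i) ^ \<alpha> i))"
      by (intro mult pow polynomial_fun_intros)
    then show ?case using insert.hyps by simp
  qed (simp_all add: const)
  then have summand: "P (\<lambda>x. c \<alpha> * (\<Prod>i\<in>UNIV. (x $ i) ^ \<alpha> i))" for \<alpha>
    by (intro mult const polynomial_fun_intros)
  show ?thesis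
    unfolding p
  proof (induction A rule: infinite_finite_induct)
    case (insert \<alpha> A)
    then have "P (\<lambda>x. c \<alpha> * (\<Prod>i\<in>UNIV. (x $ i) ^ \<alpha> i) +
        (\<Sum>\<alpha>\<in>A. c \<alpha> * (\<Prod>i\<in>UNIV. (x $ i) ^ \<alpha> i)))"
      by (intro add summand polynomial_fun_intros)
    then show ?case using insert.hyps by simp
  qed (simp_all add: const)
qed

lemma polynomial_fun_compose:
  assumes "polynomial_fun p" "polynomial_map \<Phi>"
  shows "polynomial_fun (\<lambda>x. p (\<Phi> x))"
  using assms(1)
proof (induction p rule: polynomial_fun_induct)
  case (coord i)
  then show ?case using assms(2) by (simp add: polynomial_map_def)
qed (auto intro: polynomial_fun_intros)

lemma polynomial_map_compose:
  assumes "polynomial_map f" "polynomial_map g"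
  shows "polynomial_map (\<lambda>x. f (g x))"
  unfolding polynomial_map_def
proof
  fix i
  have "polynomial_fun (\<lambda>x. f x $ i)" using assms(1) by (simp add: polynomial_map_def)
  from polynomial_fun_compose[OF this assms(2)] show "polynomial_fun (\<lambda>x. f (g x) $ i)" .
qed

text \<open>Dedekind: distinct monomials are distinct characters of the multiplicative
  monoid of the coordinate space.\<close>

lemma monomial_fun_independent:
  assumes "finite A" "\<And>x. (\<Sum>\<alpha>\<in>A. c \<alpha> * monomial_fun \<alpha> x) = 0" "\<alpha> \<in> A"
  shows "c \<alpha> = 0"
  using assms
proof (induction A arbitrary: c \<alpha> rule: finite_induct)
  case (insert \<beta> A)
  have *: "c \<alpha> = 0" if \<alpha>: "\<alpha> \<in> A" for \<alpha>
  proof -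
    have "\<alpha> \<noteq> \<beta>" using insert.hyps(2) \<alpha> by auto
    then obtain i where i: "\<alpha> i \<noteq> \<beta> i" by (auto simp: fun_eq_iff)
    \<comment> \<open>Scaling coordinate \<open>i\<close> by 2 multiplies the monomial \<gamma> by
      \<open>2 ^ \<gamma> i\<close>. Subtracting \<open>2 ^ \<beta> i\<close> times the original
      relation removes \<beta> and leaves a nonzero factor on \<open>c \<alpha>\<close>.\<close>
    define y :: "complex ^ 'a" where "y = (\<chi> j. if j = i then 2 else 1)"
    have y: "monomial_fun \<gamma> y = 2 ^ \<gamma> i" for \<gamma>
    proof -
      have "monomial_fun \<gamma> y = (\<Prod>j\<in>UNIV. if j = i then 2 ^ \<gamma> j else 1)"
        unfolding monomial_fun_def y_def by (rule prod.cong) auto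
      then show ?thesis by simp
    qed
    have "(\<Sum>\<gamma>\<in>A. (c \<gamma> * (2 ^ \<gamma> i - 2 ^ \<beta> i)) * monomial_fun \<gamma> x) = 0" for x
    proof -
      have "0 = (\<Sum>\<gamma>\<in>insert \<beta> A. c \<gamma> * monomial_fun \<gamma> (\<chi> j. y $ j * x $ j))
          - 2 ^ \<beta> i * (\<Sum>\<gamma>\<in>insert \<beta> A. c \<gamma> * monomial_fun \<gamma> x)"
        using insert.prems(1) by simp
      also have "\<dots> = (\<Sum>\<gamma>\<in>insert \<beta> A. (c \<gamma> * (2 ^ \<gamma> i - 2 ^ \<beta> i)) * monomial_fun \<gamma> x)"
        unfolding monomial_fun_mult_vec y sum_distrib_left sum_subtractf[symmetric]
        by (rule sum.cong) (auto simp: algebra_simps)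
      also have "\<dots> = (\<Sum>\<gamma>\<in>A. (c \<gamma> * (2 ^ \<gamma> i - 2 ^ \<beta> i)) * monomial_fun \<gamma> x)"
        using insert.hyps by simp
      finally show ?thesis by simp
    qed
    from insert.IH[OF this \<alpha>] have "c \<alpha> = 0 \<or> (2::complex) ^ \<alpha> i = 2 ^ \<beta> i"
      by simp
    moreover have "(2::complex) ^ \<alpha> i \<noteq> 2 ^ \<beta> i"
    proof
      assume "(2::complex) ^ \<alpha> i = 2 ^ \<beta> i"
      then have "of_nat (2 ^ \<alpha> i) = (of_nat (2 ^ \<beta> i) :: complex)" by simp
      then have "(2::nat) ^ \<alpha> i = 2 ^ \<beta> i" by (simp only: of_nat_eq_iff)
      then show False using i by simp
    qed
    ultimately show ?thesis by simp
  qed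
  \<comment> \<open>Only the term of \<beta> survives in the relation, and at the all-ones vector
    its monomial is 1.\<close>
  have "c \<beta> * monomial_fun \<beta> (\<chi> i. 1) = 0"
    using insert.prems(1)[of "\<chi> i. 1"] insert.hyps * by simp
  then have "c \<beta> = 0" by (simp add: monomial_fun_def)
  then show ?case using * insert.prems by auto
qed simp

subsection \<open>Partial derivatives and Jacobians\<close>

definition partial :: "'n::finite \<Rightarrow> (complex ^ 'n \<Rightarrow> complex) \<Rightarrow> complex ^ 'n \<Rightarrow> complex" where
  "partial i p x = deriv (\<lambda>t. p (x + axis i t)) 0"

text \<open>\<open>has_derivative\<close> is a real notion. A differential of this complex linear
  form restricts along \<open>axis i\<close> to multiplication by \<open>D i\<close>, which makes it
  a complex derivative there.\<close>

lemma partial_eqI: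
  assumes "(p has_derivative (\<lambda>h. \<Sum>i\<in>UNIV. D i * h $ i)) (at x)"
  shows "partial i p x = D i"
proof -
  have "linear (axis i :: complex \<Rightarrow> complex ^ 'a)"
    by (rule linearI) (auto simp: axis_def vec_eq_iff)
  then have "(axis i has_derivative axis i) (at (0::complex))"
    by (simp add: linear_conv_bounded_linear bounded_linear_imp_has_derivative)
  then have "((\<lambda>t. x + axis i t) has_derivative axis i) (at (0::complex))"
    using has_derivative_add[OF has_derivative_const] by fastforce
  moreover have "x + axis i (0::complex) = x"
    by (simp add: axis_def vec_eq_iff)
  ultimately have "((\<lambda>t. p (x + axis i t)) has_derivative (\<lambda>t. \<Sum>j\<in>UNIV. D j * axis i t $ j)) (at 0)"
    using has_derivative_compose[of "\<lambda>t. x + axis i t" "axis i" 0 UNIV p "\<lambda>h. \<Sum>j\<in>UNIV. D j * h $ j"] assms by metis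
  also have "(\<lambda>t. \<Sum>j\<in>UNIV. D j * axis i t $ j) = (*) (D i)"
    by (rule ext) (simp add: axis_def if_distrib cong: if_cong)
  finally show ?thesis
    unfolding partial_def by (intro DERIV_imp_deriv) (simp add: has_field_derivative_def)
qed

lemma has_derivative_partial_mult:
  assumes "(p has_derivative (\<lambda>h. \<Sum>i\<in>UNIV. D i * h $ i)) (at x)"
    and "(q has_derivative (\<lambda>h. \<Sum>i\<in>UNIV. E i * h $ i)) (at x)"
  shows "((\<lambda>x. p x * q x) has_derivative
    (\<lambda>h. \<Sum>i\<in>UNIV. (D i * q x + p x * E i) * h $ (i::'n::finite))) (at (x :: complex ^ 'n))"
  using has_derivative_mult[OF assms]
  by (rule has_derivative_eq_rhs)
     (auto simp: fun_eq_iff sum_distrib_left sum_distrib_right sum.distrib algebra_simps)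

lemma has_derivative_partial_add:
  assumes "(p has_derivative (\<lambda>h. \<Sum>i\<in>UNIV. D i * h $ i)) (at x)"
    and "(q has_derivative (\<lambda>h. \<Sum>i\<in>UNIV. E i * h $ i)) (at x)"
  shows "((\<lambda>x. p x + q x) has_derivative
    (\<lambda>h. \<Sum>i\<in>UNIV. (D i + E i) * h $ (i::'n::finite))) (at (x :: complex ^ 'n))"
  using has_derivative_add[OF assms]
  by (rule has_derivative_eq_rhs) (auto simp: fun_eq_iff sum.distrib algebra_simps)

lemma has_derivative_partial_const:
  "((\<lambda>x. c) has_derivative (\<lambda>h. \<Sum>i\<in>UNIV. 0 * h $ i)) (at (x :: complex ^ 'n::finite))"
  by simp

lemma has_derivative_partial_coord:
  "((\<lambda>x. x $ k) has_derivative (\<lambda>h. \<Sum>i\<in>UNIV. (if i = k then 1 else 0) * h $ i))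
     (at (x :: complex ^ 'n::finite))"
proof -
  have "((\<lambda>x. x $ k) has_derivative (\<lambda>h. h $ k)) (at (x :: complex ^ 'n))"
    by (intro bounded_linear_imp_has_derivative bounded_linear_vec_nth)
  then show ?thesis by (simp add: mult_delta_left)
qed

text \<open>The induction builds the differential together with polynomial coefficients for it;
  \<open>partial_eqI\<close> then identifies these with the partial derivatives.\<close>

lemma polynomial_fun_has_derivative_exists:
  assumes "polynomial_fun p"
  shows "\<exists>q. (\<forall>i. polynomial_fun (q i)) \<and>
    (\<forall>x. (p has_derivative (\<lambda>h. \<Sum>i\<in>UNIV. q i x * h $ i)) (at x))"
  using assms
proof (induction rule: polynomial_fun_induct)
  case (const c)
  show ?case
    by (intro exI[of _ "\<lambda>i x. 0"] conjI allI polynomial_fun_const has_derivative_partial_const)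
next
  case (coord k)
  show ?case
    by (intro exI[of _ "\<lambda>i x. if i = k then 1 else 0"] conjI allI polynomial_fun_const
        has_derivative_partial_coord)
next
  case (add p q)
  then obtain D E where
    "\<And>i. polynomial_fun (D i)" "\<And>i. polynomial_fun (E i)"
    "\<And>x. (p has_derivative (\<lambda>h. \<Sum>i\<in>UNIV. D i x * h $ i)) (at x)"
    "\<And>x. (q has_derivative (\<lambda>h. \<Sum>i\<in>UNIV. E i x * h $ i)) (at x)" by blast
  then show ?case
    by (intro exI[of _ "\<lambda>i x. D i x + E i x"]) (auto intro: polynomial_fun_intros has_derivative_partial_add)
next
  case (mult p q)
  then obtain D E where
    DE: "\<And>i. polynomial_fun (D i)" "\<And>i. polynomial_fun (E i)"
    "\<And>x. (p has_derivative (\<lambda>h. \<Sum>i\<in>UNIV. D i x * h $ i)) (at x)"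
    "\<And>x. (q has_derivative (\<lambda>h. \<Sum>i\<in>UNIV. E i x * h $ i)) (at x)" by blast
  with mult.hyps show ?case
    by (intro exI[of _ "\<lambda>i x. D i x * q x + p x * E i x"] conjI allI
        polynomial_fun_add polynomial_fun_mult has_derivative_partial_mult)
qed

lemma has_derivative_partial:
  assumes "polynomial_fun p"
  shows "(p has_derivative (\<lambda>h. \<Sum>i\<in>UNIV. partial i p x * h $ i)) (at x)"
proof -
  obtain q where q: "\<And>x. (p has_derivative (\<lambda>h. \<Sum>i\<in>UNIV. q i x * h $ i)) (at x)"
    using polynomial_fun_has_derivative_exists[OF assms] by blast
  have "partial i p x = q i x" for i by (rule partial_eqI[OF q])
  then show ?thesis using q by simp
qed

lemma polynomial_fun_partial:
  assumes "polynomial_fun p"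
  shows "polynomial_fun (partial i p)"
proof -
  obtain q where q: "\<And>i. polynomial_fun (q i)"
    "\<And>x. (p has_derivative (\<lambda>h. \<Sum>i\<in>UNIV. q i x * h $ i)) (at x)"
    using polynomial_fun_has_derivative_exists[OF assms] by blast
  have "partial i p = q i"
    by (rule ext) (rule partial_eqI[OF q(2)])
  then show ?thesis using q(1) by simp
qed

lemma partial_const: "partial i (\<lambda>x. c) x = 0"
  by (rule partial_eqI[where D = "\<lambda>_. 0", OF has_derivative_partial_const])

lemma partial_coord: "partial i (\<lambda>x. x $ k) x = (if i = k then 1 else 0)"
  by (rule partial_eqI[OF has_derivative_partial_coord])

lemma partial_add:
  assumes "polynomial_fun p" "polynomial_fun q"
  shows "partial i (\<lambda>x. p x + q x) x = partial i p x + partial i q x"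
  by (rule partial_eqI[OF has_derivative_partial_add]) (intro has_derivative_partial assms)+

lemma partial_mult:
  assumes "polynomial_fun p" "polynomial_fun q"
  shows "partial i (\<lambda>x. p x * q x) x = partial i p x * q x + p x * partial i q x"
  by (rule partial_eqI[OF has_derivative_partial_mult]) (intro has_derivative_partial assms)+

lemma partial_sum:
  assumes "\<And>j. j \<in> I \<Longrightarrow> polynomial_fun (p j)"
  shows "partial i (\<lambda>x. \<Sum>j\<in>I. p j x) x = (\<Sum>j\<in>I. partial i (p j) x)"
  using assms
  by (induction I rule: infinite_finite_induct)
     (auto simp: partial_const partial_add polynomial_fun_sum)

lemma partial_cmult:
  assumes "polynomial_fun p"
  shows "partial i (\<lambda>x. c * p x) x = c * partial i p x"
  by (subst partial_mult[OF polynomial_fun_const assms]) (simp add: partial_const)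

lemma partial_diff:
  assumes "polynomial_fun p" "polynomial_fun q"
  shows "partial i (\<lambda>x. p x - q x) x = partial i p x - partial i q x"
proof -
  have "partial i (\<lambda>x. p x + (-1) * q x) x = partial i p x + partial i (\<lambda>x. (-1) * q x) x"
    by (intro partial_add assms polynomial_fun_mult polynomial_fun_const)
  also have "partial i (\<lambda>x. (-1) * q x) x = - partial i q x"
    by (subst partial_mult[OF polynomial_fun_const assms(2)]) (simp add: partial_const)
  finally show ?thesis by simp
qed

lemma partial_coord_power:
  "partial i (\<lambda>x. (x $ k) ^ m) x = (if i = k then of_nat m * (x $ k) ^ (m - 1) else 0)"
proof (induction m)
  case (Suc m)
  have "partial i (\<lambda>x. (x $ k) ^ Suc m) x = partial i (\<lambda>x. x $ k * (x $ k) ^ m) x"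
    by simp
  also have "\<dots> = (if i = k then 1 else 0) * (x $ k) ^ m + x $ k * partial i (\<lambda>x. (x $ k) ^ m) x"
    by (subst partial_mult) (auto intro: polynomial_fun_intros simp: partial_coord)
  also have "\<dots> = (if i = k then of_nat (Suc m) * (x $ k) ^ (Suc m - 1) else 0)"
    unfolding Suc.IH by (cases m) (auto simp: algebra_simps)
  finally show ?case .
qed (simp add: partial_const)

text \<open>As functions of \<open>p\<close>, both sides are additive and obey the same Leibniz rule
  over composition with \<Phi>, so agreement on constants and coordinates suffices.\<close>

lemma partial_compose:
  assumes "polynomial_fun p" "polynomial_map \<Phi>"
  shows "partial i (\<lambda>x. p (\<Phi> x)) x = (\<Sum>k\<in>UNIV. partial k p (\<Phi> x) * partial i (\<lambda>x. \<Phi> x $ k) x)"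
  using assms(1)
proof (induction p rule: polynomial_fun_induct)
  case (const c)
  then show ?case by (simp add: partial_const)
next
  case (coord k)
  then show ?case by (simp add: partial_coord mult_delta_left)
next
  case (add p q)
  then show ?case
    using polynomial_fun_compose[OF _ assms(2)]
    by (simp add: partial_add sum.distrib algebra_simps)
next
  case (mult p q)
  then show ?case
    using polynomial_fun_compose[OF _ assms(2)]
    by (simp add: partial_mult sum.distrib sum_distrib_left sum_distrib_right algebra_simps)
qed

section \<open>Jacobian determinants and the chain rule\<close>

lemma jacobian_matrix_nth: "jacobian_matrix f x $ i $ j = partial j (\<lambda>x. f x $ i) x"
  by (simp add: jacobian_matrix_def partial_def)

lemma jacobian_det_compose:
  assumes "polynomial_map f" "polynomial_map g"
  shows "jacobian_det (\<lambda>x. f (g x)) x = jacobian_det f (g x) * jacobian_det g x"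
proof -
  have "jacobian_matrix (\<lambda>x. f (g x)) x = jacobian_matrix f (g x) ** jacobian_matrix g x"
    using assms(1) partial_compose[OF _ assms(2), of "\<lambda>x. f x $ _"]
    by (simp add: vec_eq_iff matrix_matrix_mult_def jacobian_matrix_nth polynomial_map_def)
  then show ?thesis by (simp add: jacobian_det_def det_mul)
qed

lemma polynomial_fun_jacobian_det:
  assumes "polynomial_map f"
  shows "polynomial_fun (jacobian_det f)"
proof -
  have "polynomial_fun (\<lambda>x. jacobian_matrix f x $ i $ j)" for i j
    using assms by (simp add: jacobian_matrix_nth polynomial_fun_partial polynomial_map_def)
  then show ?thesis
    unfolding jacobian_det_def[abs_def] det_def by (intro polynomial_fun_intros)
qed

subsection \<open>The Tjurina ideal\<close>

text \<open>With \<open>J\<close> itself among the generators, the ideal absorbs a polynomial factor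
  \<open>w\<close>: the product rule produces a multiple of \<open>J\<close> in each partial
  derivative of \<open>w J\<close>.\<close>

definition tjurina_ideal :: "(complex ^ 'n::finite \<Rightarrow> complex) \<Rightarrow> (complex ^ 'n \<Rightarrow> complex) set" where
  "tjurina_ideal J = {p. \<exists>u g. polynomial_fun u \<and> (\<forall>i. polynomial_fun (g i)) \<and>
     p = (\<lambda>x. u x * J x + (\<Sum>i\<in>UNIV. g i x * partial i J x))}"

text \<open>By the product and chain rules every generator on the side of
  \<open>w x * J (\<Phi> x)\<close> is a combination of \<open>J\<close> and its partials, all
  evaluated at \<open>\<Phi> x\<close>. Substituting \<Psi> turns these into the generators for
  \<open>J\<close>.\<close>

lemma tjurina_ideal_transform:
  assumes "polynomial_fun J" "polynomial_fun w" "polynomial_map \<Phi>" "polynomial_map \<Psi>"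
    and \<Phi>\<Psi>: "\<And>x. \<Phi> (\<Psi> x) = x"
    and p: "p \<in> tjurina_ideal (\<lambda>x. w x * J (\<Phi> x))"
  shows "(\<lambda>x. p (\<Psi> x)) \<in> tjurina_ideal J"
proof -
  obtain u g where ug: "polynomial_fun u" "\<And>i. polynomial_fun (g i)"
    and p: "p = (\<lambda>x. u x * (w x * J (\<Phi> x)) +
      (\<Sum>i\<in>UNIV. g i x * partial i (\<lambda>x. w x * J (\<Phi> x)) x))"
    using p unfolding tjurina_ideal_def by blast
  \<comment> \<open>\<open>U\<close> gathers the coefficients of \<open>J (\<Phi> x)\<close>,
    including those from differentiating \<open>w\<close>, and \<open>G k\<close> those of
    \<open>partial k J (\<Phi> x)\<close>.\<close>
  define U where "U x = u x * w x + (\<Sum>i\<in>UNIV. g i x * partial i w x)" for x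
  define G where "G k x = (\<Sum>i\<in>UNIV. g i x * w x * partial i (\<lambda>x. \<Phi> x $ k) x)" for k x
  have poly: "polynomial_fun U" "\<And>k. polynomial_fun (G k)"
    using assms(3) unfolding U_def[abs_def] G_def[abs_def] polynomial_map_def
    by (auto intro!: polynomial_fun_intros ug assms polynomial_fun_partial)
  have "p x = U x * J (\<Phi> x) + (\<Sum>k\<in>UNIV. G k x * partial k J (\<Phi> x))" for x
  proof -
    have "partial i (\<lambda>x. w x * J (\<Phi> x)) x = partial i w x * J (\<Phi> x) +
        (\<Sum>k\<in>UNIV. w x * (partial k J (\<Phi> x) * partial i (\<lambda>x. \<Phi> x $ k) x))" for i
      by (simp add: partial_mult assms polynomial_fun_compose partial_compose sum_distrib_left)
    then have "p x = U x * J (\<Phi> x) + (\<Sum>i\<in>UNIV. \<Sum>k\<in>UNIV.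
        g i x * (w x * (partial k J (\<Phi> x) * partial i (\<lambda>x. \<Phi> x $ k) x)))"
      by (simp add: p U_def distrib_left distrib_right sum.distrib sum_distrib_left
          sum_distrib_right mult.assoc)
    also have "(\<Sum>i\<in>UNIV. \<Sum>k\<in>UNIV. g i x * (w x * (partial k J (\<Phi> x) * partial i (\<lambda>x. \<Phi> x $ k) x)))
       = (\<Sum>k\<in>UNIV. G k x * partial k J (\<Phi> x))"
      unfolding G_def sum_distrib_right by (subst sum.swap) (simp add: mult_ac)
    finally show ?thesis .
  qed
  then have "p (\<Psi> x) = U (\<Psi> x) * J x + (\<Sum>k\<in>UNIV. G k (\<Psi> x) * partial k J x)" for x
    by (simp add: \<Phi>\<Psi>)
  then show ?thesis
    unfolding tjurina_ideal_def using poly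
    by (intro CollectI exI[of _ "\<lambda>x. U (\<Psi> x)"] exI[of _ "\<lambda>k x. G k (\<Psi> x)"])
       (auto intro: polynomial_fun_compose assms)
qed

subsection \<open>Ideals generated by powers of the coordinates\<close>

text \<open>Gaussian elimination: each step disposes of one equation and at most one unknown, so the
  unknowns stay in the majority and one is left over to be chosen freely.\<close>

lemma underdetermined_system:
  fixes M :: "'b \<Rightarrow> 'a \<Rightarrow> 'c::field"
  assumes "finite A" "finite B" "card A < card B"
  shows "\<exists>c. (\<exists>\<beta>\<in>B. c \<beta> \<noteq> 0) \<and> (\<forall>\<alpha>\<in>A. (\<Sum>\<beta>\<in>B. c \<beta> * M \<beta> \<alpha>) = 0)"
  using assms
proof (induction A arbitrary: B M rule: finite_induct)
  case empty
  then have "B \<noteq> {}" by auto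
  then show ?case by (intro exI[of _ "\<lambda>_. 1"]) auto
next
  case (insert a A)
  show ?case
  proof (cases "\<forall>\<beta>\<in>B. M \<beta> a = 0")
    case True
    have "card A < card B" using insert by simp
    from insert.IH[OF insert.prems(1) this, of M] True show ?thesis by auto
  next
    case False
    then obtain b where b: "b \<in> B" "M b a \<noteq> 0" by auto
    \<comment> \<open>The system after unknown \<open>b\<close> is eliminated with pivot
      \<open>M b a\<close>; equation \<open>a\<close> becomes trivial.\<close>
    define N where "N \<beta> \<alpha> = M \<beta> \<alpha> - M \<beta> a / M b a * M b \<alpha>" for \<beta> \<alpha>
    have "card A < card (B - {b})"
      using insert b by simp
    with insert.IH[of "B - {b}" N] insert.prems obtain c where
      c: "\<exists>\<beta>\<in>B - {b}. c \<beta> \<noteq> 0" "\<And>\<alpha>. \<alpha> \<in> A \<Longrightarrow> (\<Sum>\<beta>\<in>B - {b}. c \<beta> * N \<beta> \<alpha>) = 0"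
      by auto
    \<comment> \<open>Back substitution: the value at \<open>b\<close> is the one that equation
      \<open>a\<close> dictates.\<close>
    define c' where "c' = c(b := - (\<Sum>\<beta>\<in>B - {b}. c \<beta> * M \<beta> a) / M b a)"
    have eq: "(\<Sum>\<beta>\<in>B. c' \<beta> * M \<beta> \<alpha>) = (\<Sum>\<beta>\<in>B - {b}. c \<beta> * N \<beta> \<alpha>)" for \<alpha>
    proof -
      have "(\<Sum>\<beta>\<in>B. c' \<beta> * M \<beta> \<alpha>) = c' b * M b \<alpha> + (\<Sum>\<beta>\<in>B - {b}. c' \<beta> * M \<beta> \<alpha>)"
        using insert.prems b by (simp add: sum.remove)
      also have "(\<Sum>\<beta>\<in>B - {b}. c' \<beta> * M \<beta> \<alpha>) = (\<Sum>\<beta>\<in>B - {b}. c \<beta> * M \<beta> \<alpha>)"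
        by (rule sum.cong) (auto simp: c'_def)
      also have "c' b * M b \<alpha> = - (\<Sum>\<beta>\<in>B - {b}. c \<beta> * (M \<beta> a / M b a * M b \<alpha>))"
        by (simp add: c'_def sum_distrib_right sum_divide_distrib mult.assoc)
      finally show ?thesis
        by (simp add: N_def right_diff_distrib sum_subtractf)
    qed
    have "(\<Sum>\<beta>\<in>B - {b}. c \<beta> * N \<beta> a) = 0"
      using b by (simp add: N_def)
    then have "\<forall>\<alpha>\<in>insert a A. (\<Sum>\<beta>\<in>B. c' \<beta> * M \<beta> \<alpha>) = 0"
      using c(2) eq by auto
    moreover have "\<exists>\<beta>\<in>B. c' \<beta> \<noteq> 0"
      using c(1) by (auto simp: c'_def)
    ultimately show ?thesis by blast
  qed
qed

definition power_ideal :: "('n::finite \<Rightarrow> nat) \<Rightarrow> (complex ^ 'n \<Rightarrow> complex) set" where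
  "power_ideal e = {p. \<exists>g. (\<forall>i. polynomial_fun (g i)) \<and>
     p = (\<lambda>x. \<Sum>i\<in>UNIV. g i x * (x $ i) ^ e i)}"

text \<open>The exponents of the monomials divisible by none of the generators of
  \<open>power_ideal e\<close>.\<close>

definition exponent_box :: "('n::finite \<Rightarrow> nat) \<Rightarrow> ('n \<Rightarrow> nat) set" where
  "exponent_box e = {\<alpha>. \<forall>i. \<alpha> i < e i}"

lemma exponent_box_eq_PiE: "exponent_box e = PiE UNIV (\<lambda>i. {..<e i})"
  by (auto simp: exponent_box_def PiE_def Pi_def)

lemma finite_exponent_box: "finite (exponent_box e)"
  by (simp add: exponent_box_eq_PiE finite_PiE)

lemma card_exponent_box: "card (exponent_box e) = (\<Prod>i\<in>UNIV. e i)"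
  by (simp add: exponent_box_eq_PiE card_PiE)

lemma power_ideal_add:
  assumes "p \<in> power_ideal e" "q \<in> power_ideal e"
  shows "(\<lambda>x. p x + q x) \<in> power_ideal e"
proof -
  obtain g h where g: "\<And>i. polynomial_fun (g i)" "p = (\<lambda>x. \<Sum>i\<in>UNIV. g i x * (x $ i) ^ e i)"
    and h: "\<And>i. polynomial_fun (h i)" "q = (\<lambda>x. \<Sum>i\<in>UNIV. h i x * (x $ i) ^ e i)"
    using assms unfolding power_ideal_def by blast
  show ?thesis
    unfolding power_ideal_def g h
    by (intro CollectI exI[of _ "\<lambda>i x. g i x + h i x"])
       (auto simp: distrib_right sum.distrib intro!: polynomial_fun_add g h)
qed

lemma power_ideal_mult:
  assumes "polynomial_fun q" "p \<in> power_ideal e"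
  shows "(\<lambda>x. q x * p x) \<in> power_ideal e"
proof -
  obtain g where g: "\<And>i. polynomial_fun (g i)" "p = (\<lambda>x. \<Sum>i\<in>UNIV. g i x * (x $ i) ^ e i)"
    using assms unfolding power_ideal_def by blast
  show ?thesis
    unfolding power_ideal_def g
    by (intro CollectI exI[of _ "\<lambda>i x. q x * g i x"])
       (auto simp: sum_distrib_left mult.assoc intro!: polynomial_fun_mult assms g)
qed

lemma power_ideal_zero: "(\<lambda>x. 0) \<in> power_ideal e"
  unfolding power_ideal_def
  by (intro CollectI exI[of _ "\<lambda>i x. 0"]) (auto simp: polynomial_fun_const)

lemma power_ideal_sum:
  "(\<And>i. i \<in> I \<Longrightarrow> p i \<in> power_ideal e) \<Longrightarrow> (\<lambda>x. \<Sum>i\<in>I. p i x) \<in> power_ideal e"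
  by (induction I rule: infinite_finite_induct) (auto simp: power_ideal_add power_ideal_zero)

lemma power_ideal_generator:
  assumes "e i \<le> m"
  shows "(\<lambda>x. (x $ i) ^ m) \<in> power_ideal e"
proof -
  have "(x $ i) ^ m = (\<Sum>j\<in>UNIV. (if j = i then (x $ i) ^ (m - e i) else 0) * (x $ j) ^ e j)"
    for x :: "complex ^ 'a"
  proof -
    have "(x $ i) ^ m = (x $ i) ^ (m - e i) * (x $ i) ^ e i"
      using assms by (metis le_add_diff_inverse2 power_add)
    then show ?thesis by (simp add: mult_delta_left)
  qed
  moreover have "polynomial_fun (\<lambda>x. if j = i then (x $ i) ^ (m - e i) else 0)" for j
    by (cases "j = i") (auto intro: polynomial_fun_intros)
  ultimately show ?thesis
    unfolding power_ideal_def
    by (intro CollectI exI[of _ "\<lambda>j x. if j = i then (x $ i) ^ (m - e i) else 0"]) auto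
qed

lemma monomial_in_power_ideal:
  assumes "\<alpha> \<notin> exponent_box e"
  shows "monomial_fun \<alpha> \<in> power_ideal e"
proof -
  obtain i where i: "e i \<le> \<alpha> i" using assms by (auto simp: exponent_box_def not_less)
  have "monomial_fun \<alpha> = (\<lambda>x. (\<Prod>j\<in>UNIV - {i}. (x $ j) ^ \<alpha> j) * (x $ i) ^ \<alpha> i)"
    unfolding monomial_fun_def by (subst prod.remove[of UNIV i]) (simp_all add: mult.commute)
  moreover have "(\<lambda>x. (\<Prod>j\<in>UNIV - {i}. (x $ j) ^ \<alpha> j) * (x $ i) ^ \<alpha> i) \<in> power_ideal e"
    by (intro power_ideal_mult power_ideal_generator i polynomial_fun_prod polynomial_fun_power
        polynomial_fun_coord)
  ultimately show ?thesis by simp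
qed

text \<open>Spanning half of the basis property: the terms of \<open>p\<close> outside the box lie
  in the ideal, so the remaining terms represent \<open>p\<close>.\<close>

lemma polynomial_mod_power_ideal:
  assumes "polynomial_fun p"
  shows "\<exists>c. (\<lambda>x. p x - (\<Sum>\<alpha>\<in>exponent_box e. c \<alpha> * monomial_fun \<alpha> x)) \<in> power_ideal e"
proof -
  obtain A c where A: "finite A" "\<And>x. p x = (\<Sum>\<alpha>\<in>A. c \<alpha> * monomial_fun \<alpha> x)"
    using assms unfolding polynomial_fun_iff supported_poly_def by blast
  define c' where "c' \<alpha> = (if \<alpha> \<in> A then c \<alpha> else 0)" for \<alpha>
  have "p x - (\<Sum>\<alpha>\<in>exponent_box e. c' \<alpha> * monomial_fun \<alpha> x)
      = (\<Sum>\<alpha>\<in>A - exponent_box e. c \<alpha> * monomial_fun \<alpha> x)" for x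
  proof -
    have "(\<Sum>\<alpha>\<in>exponent_box e. c' \<alpha> * monomial_fun \<alpha> x)
        = (\<Sum>\<alpha>\<in>A \<inter> exponent_box e. c \<alpha> * monomial_fun \<alpha> x)"
      unfolding c'_def by (rule sum.mono_neutral_cong_right) (auto simp: finite_exponent_box)
    then show ?thesis
      using A(1) by (simp add: A(2) sum.Int_Diff[of A _ "exponent_box e"])
  qed
  moreover have "(\<lambda>x. \<Sum>\<alpha>\<in>A - exponent_box e. c \<alpha> * monomial_fun \<alpha> x) \<in> power_ideal e"
    by (intro power_ideal_sum power_ideal_mult[OF polynomial_fun_const] monomial_in_power_ideal) auto
  ultimately show ?thesis by (intro exI[of _ c']) simp
qed

text \<open>Each term of a multiple of \<open>(x $ i) ^ e i\<close> has exponent at least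
  \<open>e i\<close> in coordinate \<open>i\<close>, which puts it outside the box.\<close>

lemma power_ideal_supported:
  assumes "p \<in> power_ideal e"
  shows "supported_poly (- exponent_box e) p"
proof -
  obtain g where g: "\<And>i. polynomial_fun (g i)" "p = (\<lambda>x. \<Sum>i\<in>UNIV. g i x * (x $ i) ^ e i)"
    using assms unfolding power_ideal_def by blast
  have "supported_poly (- exponent_box e) (\<lambda>x. g i x * (x $ i) ^ e i)" for i
  proof (rule supported_poly_mult)
    show "supported_poly UNIV (g i)" using g(1) by (simp add: polynomial_fun_iff)
    show "supported_poly {\<lambda>j. if j = i then e i else 0} (\<lambda>x. (x $ i) ^ e i)"
      using supported_poly_monomial[of "\<lambda>j. if j = i then e i else 0"]
      by (simp add: monomial_fun_single[abs_def])
  qed (auto simp: exponent_box_def not_less intro!: exI[of _ i])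
  then show ?thesis unfolding g by (intro supported_poly_sum)
qed

text \<open>Independence half of the basis property: an element of the ideal also has an expansion
  supported off the box, and independence of monomials makes two expansions with disjoint supports
  vanish.\<close>

lemma box_combination_in_power_ideal:
  assumes "(\<lambda>x. \<Sum>\<alpha>\<in>exponent_box e. c \<alpha> * monomial_fun \<alpha> x) \<in> power_ideal e"
    and "\<alpha> \<in> exponent_box e"
  shows "c \<alpha> = 0"
proof -
  let ?B = "exponent_box e"
  obtain G k where G: "finite G" "G \<subseteq> - ?B"
    "\<And>x. (\<Sum>\<alpha>\<in>?B. c \<alpha> * monomial_fun \<alpha> x) = (\<Sum>\<alpha>\<in>G. k \<alpha> * monomial_fun \<alpha> x)"
    using power_ideal_supported[OF assms(1)] unfolding supported_poly_def by blast
  \<comment> \<open>Both expansions form one relation over a disjoint union, the outer one with its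
    sign reversed.\<close>
  define c' where "c' \<alpha> = (if \<alpha> \<in> ?B then c \<alpha> else - k \<alpha>)" for \<alpha>
  have "(\<Sum>\<alpha>\<in>?B \<union> G. c' \<alpha> * monomial_fun \<alpha> x) = 0" for x
  proof -
    have "(\<Sum>\<alpha>\<in>?B \<union> G. c' \<alpha> * monomial_fun \<alpha> x)
        = (\<Sum>\<alpha>\<in>?B. c' \<alpha> * monomial_fun \<alpha> x) + (\<Sum>\<alpha>\<in>G. c' \<alpha> * monomial_fun \<alpha> x)"
      using G by (intro sum.union_disjoint) (auto simp: finite_exponent_box)
    also have "(\<Sum>\<alpha>\<in>?B. c' \<alpha> * monomial_fun \<alpha> x) = (\<Sum>\<alpha>\<in>?B. c \<alpha> * monomial_fun \<alpha> x)"
      by (simp add: c'_def)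
    also have "(\<Sum>\<alpha>\<in>G. c' \<alpha> * monomial_fun \<alpha> x) = (\<Sum>\<alpha>\<in>G. - (k \<alpha> * monomial_fun \<alpha> x))"
      using G by (intro sum.cong) (auto simp: c'_def)
    finally show ?thesis using G(3)[of x] by (simp add: sum_negf)
  qed
  from monomial_fun_independent[OF _ this, of \<alpha>] G assms(2) show ?thesis
    by (auto simp: c'_def finite_exponent_box)
qed

text \<open>The monomials with exponents in the box are a basis of the quotient by the power ideal, so
  this compares the dimensions under the surjection \<open>p \<mapsto> p \<circ> \<Psi>\<close> of the quotients.\<close>

lemma card_exponent_box_le:
  assumes "polynomial_map \<Phi>" and \<Phi>\<Psi>: "\<And>x. \<Phi> (\<Psi> x) = x"
    and ideal: "\<And>p. p \<in> power_ideal e2 \<Longrightarrow> (\<lambda>x. p (\<Psi> x)) \<in> power_ideal e1"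
  shows "card (exponent_box e1) \<le> card (exponent_box e2)"
proof (rule ccontr)
  let ?B1 = "exponent_box e1" and ?B2 = "exponent_box e2"
  assume less: "\<not> card ?B1 \<le> card ?B2"
  \<comment> \<open>The coordinates \<open>M \<beta>\<close> of
    \<open>monomial_fun \<beta> \<circ> \<Phi>\<close> modulo \<open>power_ideal e2\<close>, with
    respect to the box monomials of \<open>e2\<close>.\<close>
  have "\<forall>\<beta>. \<exists>m. (\<lambda>x. monomial_fun \<beta> (\<Phi> x) - (\<Sum>\<alpha>\<in>?B2. m \<alpha> * monomial_fun \<alpha> x)) \<in> power_ideal e2"
    using polynomial_mod_power_ideal polynomial_fun_compose[OF polynomial_fun_monomial assms(1)]
    by blast
  from choice[OF this] obtain M where M: "\<And>\<beta>. (\<lambda>x. monomial_fun \<beta> (\<Phi> x) -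
      (\<Sum>\<alpha>\<in>?B2. M \<beta> \<alpha> * monomial_fun \<alpha> x)) \<in> power_ideal e2" by (elim exE) (rule that, erule spec)
  \<comment> \<open>There are more monomials than coordinates, so a nontrivial combination of the
    compositions with \<Phi> has all coordinates zero and thus lies in
    \<open>power_ideal e2\<close>.\<close>
  obtain c where c: "\<exists>\<beta>\<in>?B1. c \<beta> \<noteq> 0" "\<And>\<alpha>. \<alpha> \<in> ?B2 \<Longrightarrow> (\<Sum>\<beta>\<in>?B1. c \<beta> * M \<beta> \<alpha>) = 0"
    using underdetermined_system[of ?B2 ?B1 M] less by (auto simp: finite_exponent_box)
  have "(\<Sum>\<beta>\<in>?B1. c \<beta> * (monomial_fun \<beta> (\<Phi> x) - (\<Sum>\<alpha>\<in>?B2. M \<beta> \<alpha> * monomial_fun \<alpha> x)))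
      = (\<Sum>\<beta>\<in>?B1. c \<beta> * monomial_fun \<beta> (\<Phi> x))" for x
  proof -
    have "(\<Sum>\<beta>\<in>?B1. c \<beta> * (\<Sum>\<alpha>\<in>?B2. M \<beta> \<alpha> * monomial_fun \<alpha> x))
        = (\<Sum>\<alpha>\<in>?B2. (\<Sum>\<beta>\<in>?B1. c \<beta> * M \<beta> \<alpha>) * monomial_fun \<alpha> x)"
      unfolding sum_distrib_left sum_distrib_right by (subst sum.swap) (simp add: mult.assoc)
    also have "\<dots> = 0" using c(2) by simp
    finally show ?thesis by (simp add: right_diff_distrib sum_subtractf)
  qed
  moreover have "(\<lambda>x. \<Sum>\<beta>\<in>?B1. c \<beta> * (monomial_fun \<beta> (\<Phi> x) -
      (\<Sum>\<alpha>\<in>?B2. M \<beta> \<alpha> * monomial_fun \<alpha> x))) \<in> power_ideal e2"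
    by (intro power_ideal_sum power_ideal_mult[OF polynomial_fun_const] M)
  ultimately have "(\<lambda>x. \<Sum>\<beta>\<in>?B1. c \<beta> * monomial_fun \<beta> (\<Phi> x)) \<in> power_ideal e2"
    by simp
  \<comment> \<open>Composing with \<Psi> cancels \<Phi> and yields a nontrivial relation between
    box monomials modulo \<open>power_ideal e1\<close>.\<close>
  from ideal[OF this] have "(\<lambda>x. \<Sum>\<beta>\<in>?B1. c \<beta> * monomial_fun \<beta> x) \<in> power_ideal e1"
    by (simp add: \<Phi>\<Psi>)
  from box_combination_in_power_ideal[OF this] c(1) show False by blast
qed

subsection \<open>The Jacobian of the maps and the invariant\<close>

text \<open>The exponents in the partial derivatives of the Jacobian determinant: one below the
  \<open>d - 1\<close> of coordinate \<open>l\<close>, and one below \<open>a i\<close>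
  elsewhere.\<close>

definition milnor_exponent :: "'n \<Rightarrow> nat \<Rightarrow> ('n \<Rightarrow> nat) \<Rightarrow> 'n \<Rightarrow> nat" where
  "milnor_exponent l d a i = (if i = l then d - 2 else a i - 1)"

lemma polynomial_map_f_map: "polynomial_map (f_map l d a)"
  unfolding polynomial_map_def
proof
  fix i
  show "polynomial_fun (\<lambda>x. f_map l d a x $ i)"
    by (cases "i = l") (auto simp: f_map_def intro!: polynomial_fun_intros)
qed

text \<open>Such a matrix is the identity with row \<open>l\<close> replaced by a linear combination
  of the rows of the identity, so Cramer's lemma gives its determinant. The Jacobian matrix of
  \<open>f_map\<close> has this shape.\<close>

lemma det_identity_except_row:
  fixes A :: "'a::field ^ 'n::finite ^ 'n"
  assumes "\<And>i j. i \<noteq> l \<Longrightarrow> A $ i $ j = (if i = j then 1 else 0)"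
  shows "det A = A $ l $ l"
proof -
  have "(\<Sum>i\<in>UNIV. A $ l $ i *s row i (mat 1 :: 'a ^ 'n ^ 'n)) = A $ l"
    by (simp add: vec_eq_iff row_def mat_def mult_delta_right)
  then have "A = (\<chi> i. if i = l then \<Sum>i\<in>UNIV. A $ l $ i *s row i (mat 1) else row i (mat 1))"
    using assms by (simp add: vec_eq_iff row_def mat_def)
  then have "det A = A $ l $ l * det (mat 1 :: 'a ^ 'n ^ 'n)"
    using cramer_lemma_transpose[where x = "A $ l" and A = "mat 1" and k = l] by metis
  then show ?thesis by simp
qed

lemma jacobian_det_f_map:
  assumes "\<And>i. i \<noteq> l \<Longrightarrow> a i \<noteq> 0"
  shows "jacobian_det (f_map l d a) x =
    of_nat d * ((x $ l) ^ (d - 1) - (\<Sum>j\<in>UNIV - {l}. (x $ j) ^ a j))"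
proof -
  have "jacobian_det (f_map l d a) x = jacobian_matrix (f_map l d a) x $ l $ l"
    unfolding jacobian_det_def
    by (rule det_identity_except_row) (simp add: jacobian_matrix_nth f_map_def partial_coord)
  also have "\<dots> = partial l (\<lambda>x. (x $ l) ^ d -
      (of_nat d * (\<Sum>j\<in>UNIV - {l}. (x $ j) ^ a j)) * x $ l) x"
    by (simp add: jacobian_matrix_nth f_map_def)
  also have "\<dots> = of_nat d * (x $ l) ^ (d - 1) - of_nat d * (\<Sum>j\<in>UNIV - {l}. (x $ j) ^ a j)"
    by (simp add: partial_diff partial_mult partial_sum partial_const partial_coord
        partial_coord_power polynomial_fun_intros)
  finally show ?thesis by (simp add: right_diff_distrib)
qed

lemma partial_jacobian_det_f_map:
  assumes "\<And>i. i \<noteq> l \<Longrightarrow> a i \<noteq> 0"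
  shows "partial i (jacobian_det (f_map l d a)) x =
    of_nat d * (if i = l then of_nat (d - 1) else - of_nat (a i)) * (x $ i) ^ milnor_exponent l d a i"
proof -
  let ?P = "\<lambda>x. (x $ l) ^ (d - 1)" and ?Q = "\<lambda>x. \<Sum>j\<in>UNIV - {l}. (x $ j) ^ a j"
  have poly: "polynomial_fun ?P" "polynomial_fun ?Q"
    by (intro polynomial_fun_intros)+
  have "jacobian_det (f_map l d a) = (\<lambda>x. of_nat d * (?P x - ?Q x))"
    by (intro ext jacobian_det_f_map assms)
  then have "partial i (jacobian_det (f_map l d a)) x = of_nat d * (partial i ?P x - partial i ?Q x)"
    using partial_cmult[OF polynomial_fun_diff[OF poly]] partial_diff[OF poly] by simp
  also have "partial i ?Q x = (\<Sum>j\<in>UNIV - {l}. partial i (\<lambda>x. (x $ j) ^ a j) x)"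
    by (intro partial_sum polynomial_fun_intros)
  also have "\<dots> = (if i = l then 0 else of_nat (a i) * (x $ i) ^ (a i - 1))"
    by (simp add: partial_coord_power)
  finally show ?thesis
    by (cases "i = l") (simp_all add: partial_coord_power milnor_exponent_def numeral_2_eq_2)
qed

text \<open>The partials are nonzero multiples \<open>k i\<close> of the generators of the power
  ideal. The Jacobian determinant already lies in that ideal, as its terms have exponents
  \<open>d - 1\<close> and \<open>a i\<close>, above the exponents of the generators.\<close>

lemma tjurina_ideal_f_map:
  assumes "d \<ge> 3" "\<And>i. i \<noteq> l \<Longrightarrow> a i \<ge> 2"
  shows "tjurina_ideal (jacobian_det (f_map l d a)) = power_ideal (milnor_exponent l d a)"
    (is "tjurina_ideal ?J = power_ideal ?e")
proof -
  have a: "a i \<noteq> 0" if "i \<noteq> l" for i using assms(2)[OF that] by simp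
  define k :: "'a \<Rightarrow> complex" where
    "k i = of_nat d * (if i = l then of_nat (d - 1) else - of_nat (a i))" for i
  have k: "k i \<noteq> 0" for i using a[of i] assms(1) by (simp add: k_def)
  have J: "?J = (\<lambda>x. of_nat d * ((x $ l) ^ (d - 1) + (-1) * (\<Sum>j\<in>UNIV - {l}. (x $ j) ^ a j)))"
  proof
    show "?J x = of_nat d * ((x $ l) ^ (d - 1) + (-1) * (\<Sum>j\<in>UNIV - {l}. (x $ j) ^ a j))" for x
      using jacobian_det_f_map[of l a d x, OF a] by simp
  qed
  have dJ: "partial i ?J x = k i * (x $ i) ^ ?e i" for i x
    unfolding k_def by (rule partial_jacobian_det_f_map[OF a])
  have J_in: "?J \<in> power_ideal ?e"
    unfolding J
    by (intro power_ideal_mult[OF polynomial_fun_const] power_ideal_add power_ideal_sum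
        power_ideal_generator) (auto simp: milnor_exponent_def)
  show ?thesis
  proof (intro equalityI subsetI)
    fix p assume "p \<in> tjurina_ideal ?J"
    then obtain u g where "polynomial_fun u" "\<And>i. polynomial_fun (g i)"
      and p: "p = (\<lambda>x. u x * ?J x + (\<Sum>i\<in>UNIV. g i x * (k i * (x $ i) ^ ?e i)))"
      unfolding tjurina_ideal_def dJ by blast
    then show "p \<in> power_ideal ?e"
      unfolding p by (intro power_ideal_add power_ideal_sum power_ideal_mult J_in
          power_ideal_generator polynomial_fun_const) auto
  next
    fix p assume "p \<in> power_ideal ?e"
    then obtain g where g: "\<And>i. polynomial_fun (g i)"
      and p: "p = (\<lambda>x. \<Sum>i\<in>UNIV. g i x * (x $ i) ^ ?e i)"
      unfolding power_ideal_def by blast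
    have "p = (\<lambda>x. 0 * ?J x + (\<Sum>i\<in>UNIV. (inverse (k i) * g i x) * partial i ?J x))"
    proof -
      have "inverse (k i) * g i x * (k i * y) = g i x * y" for i x y
        using k[of i] by simp
      then show ?thesis unfolding p dJ by (simp only: mult_zero_left add_0_left)
    qed
    then show "p \<in> tjurina_ideal ?J"
      unfolding tjurina_ideal_def
      by (intro CollectI exI[of _ "\<lambda>x. 0"] exI[of _ "\<lambda>i x. inverse (k i) * g i x"])
         (auto intro: polynomial_fun_const polynomial_fun_mult g)
  qed
qed

section \<open>Invariance under equivalence\<close>

lemma equivalent_maps_sym:
  assumes "equivalent_maps f g"
  shows "equivalent_maps g f"
proof -
  obtain \<Phi>1 \<Phi>2 where "polynomial_automorphism \<Phi>1" "polynomial_automorphism \<Phi>2"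
    and g: "g = \<Phi>2 \<circ> f \<circ> \<Phi>1"
    using assms unfolding equivalent_maps_def by blast
  then obtain \<Psi>1 \<Psi>2 where "polynomial_map \<Phi>1" "polynomial_map \<Psi>1" "\<Psi>1 \<circ> \<Phi>1 = id" "\<Phi>1 \<circ> \<Psi>1 = id"
    "polynomial_map \<Phi>2" "polynomial_map \<Psi>2" "\<Psi>2 \<circ> \<Phi>2 = id" "\<Phi>2 \<circ> \<Psi>2 = id"
    unfolding polynomial_automorphism_def by blast
  moreover from this have "f = \<Psi>2 \<circ> g \<circ> \<Psi>1"
    by (simp add: g fun_eq_iff)
  ultimately show ?thesis
    unfolding equivalent_maps_def polynomial_automorphism_def by blast
qed

lemma equivalent_maps_milnor_le:
  fixes l :: "'n::finite"
  assumes d: "d \<ge> 3" and a: "\<And>i. i \<noteq> l \<Longrightarrow> a i \<ge> 2" and b: "\<And>i. i \<noteq> l \<Longrightarrow> b i \<ge> 2"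
    and "equivalent_maps (f_map l d a) (f_map l d b)"
  shows "(\<Prod>i\<in>UNIV. milnor_exponent l d a i) \<le> (\<Prod>i\<in>UNIV. milnor_exponent l d b i)"
proof -
  let ?f = "f_map l d a" and ?g = "f_map l d b"
  obtain \<Phi>1 \<Phi>2 where "polynomial_automorphism \<Phi>1" "polynomial_automorphism \<Phi>2"
    and g: "?g = \<Phi>2 \<circ> ?f \<circ> \<Phi>1"
    using assms(4) unfolding equivalent_maps_def by blast
  then obtain \<Psi> where poly: "polynomial_map \<Phi>1" "polynomial_map \<Phi>2" "polynomial_map \<Psi>"
    and inv: "\<Phi>1 \<circ> \<Psi> = id"
    unfolding polynomial_automorphism_def by blast
  \<comment> \<open>The factors that the chain rule contributes for the two automorphisms.\<close>
  define w where "w x = jacobian_det \<Phi>2 (?f (\<Phi>1 x)) * jacobian_det \<Phi>1 x" for x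
  have "jacobian_det ?g x = w x * jacobian_det ?f (\<Phi>1 x)" for x
    using jacobian_det_compose[OF poly(2) polynomial_map_compose[OF polynomial_map_f_map poly(1)]]
      jacobian_det_compose[OF polynomial_map_f_map poly(1)]
    by (simp add: g w_def comp_def)
  then have J: "jacobian_det ?g = (\<lambda>x. w x * jacobian_det ?f (\<Phi>1 x))" by blast
  have w: "polynomial_fun w"
    unfolding w_def[abs_def]
    by (rule polynomial_fun_mult[OF polynomial_fun_compose[OF polynomial_fun_jacobian_det[OF poly(2)]
          polynomial_map_compose[OF polynomial_map_f_map poly(1)]] polynomial_fun_jacobian_det[OF poly(1)]])
  have "card (exponent_box (milnor_exponent l d a)) \<le> card (exponent_box (milnor_exponent l d b))"
  proof (rule card_exponent_box_le[OF poly(1)])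
    show "\<Phi>1 (\<Psi> x) = x" for x using inv by (simp add: fun_eq_iff)
    fix p assume "p \<in> power_ideal (milnor_exponent l d b)"
    then have "p \<in> tjurina_ideal (\<lambda>x. w x * jacobian_det ?f (\<Phi>1 x))"
      using tjurina_ideal_f_map[OF d, of l b, OF b] J by simp
    then have "(\<lambda>x. p (\<Psi> x)) \<in> tjurina_ideal (jacobian_det ?f)"
      using inv by (intro tjurina_ideal_transform[OF _ w poly(1,3)])
        (auto simp: fun_eq_iff polynomial_fun_jacobian_det polynomial_map_f_map)
    then show "(\<lambda>x. p (\<Psi> x)) \<in> power_ideal (milnor_exponent l d a)"
      using tjurina_ideal_f_map[OF d, of l a, OF a] by simp
  qed
  then show ?thesis by (simp add: card_exponent_box)
qed

lemma equivalent_maps_prod_eq: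
  fixes l :: "'n::finite"
  assumes d: "d \<ge> 3" and a: "\<And>i. i \<noteq> l \<Longrightarrow> a i \<ge> 2" and b: "\<And>i. i \<noteq> l \<Longrightarrow> b i \<ge> 2"
    and eq: "equivalent_maps (f_map l d a) (f_map l d b)"
  shows "(\<Prod>i\<in>UNIV - {l}. a i - 1) = (\<Prod>i\<in>UNIV - {l}. b i - 1)"
proof -
  have prod: "(\<Prod>i\<in>UNIV. milnor_exponent l d c i) = (d - 2) * (\<Prod>i\<in>UNIV - {l}. c i - 1)" for c
    by (subst prod.remove[of UNIV l]) (auto simp: milnor_exponent_def)
  \<comment> \<open>Both directions of the equivalence give opposite inequalities; the common factor
    \<open>d - 2\<close> is positive because \<open>d \<ge> 3\<close>, so it cancels.\<close>
  show ?thesis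
    using equivalent_maps_milnor_le[OF d a b eq]
      equivalent_maps_milnor_le[OF d b a equivalent_maps_sym[OF eq]] d
    by (simp add: prod)
qed

subsection \<open>Covering spaces and fibres\<close>

text \<open>The order of a root exceeds its order in the derivative by one, hence is 1 here, and
  over the complex numbers the orders of the roots add up to the degree.\<close>

lemma card_simple_roots:
  fixes p :: "complex poly"
  assumes "p \<noteq> 0" "\<And>x. poly p x = 0 \<Longrightarrow> poly (pderiv p) x \<noteq> 0"
  shows "card {x. poly p x = 0} = degree p"
proof -
  have "order x p = 1" if "poly p x = 0" for x
    using order_pderiv[OF assms(1) that] order_0I[OF assms(2)[OF that]] by simp
  then have "(\<Sum>x | poly p x = 0. order x p) = card {x. poly p x = 0}"
    by simp
  moreover have "size (proots p) = (\<Sum>x | poly p x = 0. order x p)"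
    using assms(1) by (simp add: size_multiset_overloaded_eq)
  ultimately show ?thesis by (simp add: size_proots_complex)
qed

text \<open>Disjoint neighbourhoods of the \<open>k\<close> points over \<open>y\<close> have open
  images by invariance of domain. Over the intersection of these images each neighbourhood
  contributes a point to every fibre, and the count \<open>k\<close> leaves no room for further
  points.\<close>

lemma covering_space_locally_injective:
  fixes f :: "'a::euclidean_space \<Rightarrow> 'a"
  assumes cont: "continuous_on UNIV f"
    and inj: "\<And>x. f x \<in> S \<Longrightarrow> \<exists>U. open U \<and> x \<in> U \<and> inj_on f U"
    and fibre: "\<And>y. y \<in> S \<Longrightarrow> finite (f -` {y}) \<and> card (f -` {y}) = k"
    and "k > 0"
  shows "covering_space (f -` S) f S"
proof
  show "continuous_on (f -` S) f" using cont continuous_on_subset by blast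
  have "\<exists>x. f x = y" if "y \<in> S" for y
    using fibre[OF that] \<open>k > 0\<close> by (cases "f -` {y} = {}") auto
  then show "f ` (f -` S) = S" by force
next
  fix y assume y: "y \<in> S"
  let ?F = "f -` {y}"
  have F: "finite ?F" "card ?F = k" using fibre[OF y] by auto
  have "\<exists>V. open V \<and> x \<in> V \<and> inj_on f V" if "x \<in> ?F" for x
    using that y by (intro inj) simp
  then have "\<forall>x\<in>?F. \<exists>V. open V \<and> x \<in> V \<and> inj_on f V" by (rule ballI)
  from bchoice[OF this] obtain V
    where V: "\<forall>x\<in>?F. open (V x) \<and> x \<in> V x \<and> inj_on f (V x)" ..
  have "\<forall>x\<in>?F. \<exists>r>0. \<forall>x'\<in>?F. x' \<noteq> x \<longrightarrow> r \<le> dist x x'"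
    using finite_set_avoid[OF F(1)] by (intro ballI)
  from bchoice[OF this] obtain r
    where r: "\<forall>x\<in>?F. r x > 0 \<and> (\<forall>x'\<in>?F. x' \<noteq> x \<longrightarrow> r x \<le> dist x x')" ..
  have sep: "r x \<le> dist x x'" if "x \<in> ?F" "x' \<in> ?F" "x' \<noteq> x" for x x'
    using r that by blast
  \<comment> \<open>Half of the distance \<open>r x\<close> to the other points of the fibre keeps
    these sets disjoint.\<close>
  define U where "U x = V x \<inter> ball x (r x / 2)" for x
  have U: "open (U x)" "x \<in> U x" "inj_on f (U x)" if "x \<in> ?F" for x
    using bspec[OF V that] bspec[OF r that] by (auto simp: U_def intro: inj_on_subset)
  have disj: "x = x'" if "x \<in> ?F" "x' \<in> ?F" "z \<in> U x" "z \<in> U x'" for x x' z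
  proof (rule ccontr)
    assume "x \<noteq> x'"
    then have "r x \<le> dist x x'" "r x' \<le> dist x x'"
      using sep[OF that(1,2)] sep[OF that(2,1)] by (simp_all add: dist_commute)
    moreover have "dist x z < r x / 2" "dist x' z < r x' / 2" using that by (auto simp: U_def)
    moreover have "dist x x' \<le> dist x z + dist x' z" by (rule dist_triangle2)
    ultimately show False by linarith
  qed
  have image: "open (f ` U x)" if "x \<in> ?F" for x
    using U[OF that] cont by (intro invariance_of_domain) (auto intro: continuous_on_subset)
  define W where "W = (\<Inter>x\<in>?F. f ` U x)"
  define T where "T = S \<inter> W"
  have W: "open W" unfolding W_def using F image by (intro open_INT) auto
  have y_T: "y \<in> T" using y U by (auto simp: T_def W_def)
  have T_image: "T \<subseteq> f ` U x" if "x \<in> ?F" for x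
    using that unfolding T_def W_def by blast
  let ?v = "(\<lambda>x. U x \<inter> f -` T) ` ?F"
  have "\<Union>?v = f -` S \<inter> f -` T"
  proof (intro equalityI subsetI)
    fix z assume z: "z \<in> f -` S \<inter> f -` T"
    have "\<exists>u. u \<in> U x \<and> f u = f z" if "x \<in> ?F" for x
      using T_image[OF that] z by fastforce
    then have "\<forall>x\<in>?F. \<exists>u. u \<in> U x \<and> f u = f z" by (rule ballI)
    from bchoice[OF this] obtain h where h: "\<forall>x\<in>?F. h x \<in> U x \<and> f (h x) = f z" ..
    \<comment> \<open>The \<open>k\<close> chosen preimages of \<open>f z\<close> are distinct, so
      they exhaust its fibre and \<open>z\<close> is one of them.\<close>
    have "inj_on h ?F"
    proof (rule inj_onI)
      fix x x' assume x: "x \<in> ?F" "x' \<in> ?F" "h x = h x'"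
      have "h x \<in> U x" "h x' \<in> U x'" using h x(1,2) by blast+
      then show "x = x'" using disj[OF x(1,2), of "h x"] x(3) by simp
    qed
    then have "card (h ` ?F) = k" using F by (simp add: card_image)
    moreover have "h ` ?F \<subseteq> f -` {f z}" using h by blast
    moreover have "finite (f -` {f z})" "card (f -` {f z}) = k" using fibre z by auto
    ultimately have "h ` ?F = f -` {f z}" by (intro card_subset_eq) auto
    then obtain x where "x \<in> ?F" "z = h x" by blast
    then have "x \<in> ?F" "z \<in> U x" using h by blast+
    then show "z \<in> \<Union>?v" using z by blast
  qed (auto simp: T_def)
  moreover have "openin (top_of_set (f -` S)) u" if "u \<in> ?v" for u
  proof -
    obtain x where x: "x \<in> ?F" "u = U x \<inter> f -` T" using \<open>u \<in> ?v\<close> by blast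
    have "u = f -` S \<inter> (U x \<inter> f -` W)" using x by (auto simp: T_def)
    moreover have "open (U x \<inter> f -` W)"
      using U[OF x(1)] W cont by (intro open_Int open_vimage)
    ultimately show ?thesis by (simp add: openin_open_Int)
  qed
  moreover have "pairwise disjnt ?v"
  proof (rule pairwiseI)
    fix A B assume "A \<in> ?v" "B \<in> ?v" "A \<noteq> B"
    then obtain x x' where "x \<in> ?F" "x' \<in> ?F" "x \<noteq> x'"
      and AB: "A = U x \<inter> f -` T" "B = U x' \<inter> f -` T" by blast
    then have "U x \<inter> U x' = {}" using disj[of x x'] by blast
    then show "disjnt A B" unfolding AB disjnt_def by blast
  qed
  moreover have "\<exists>q. homeomorphism u T f q" if "u \<in> ?v" for u
  proof -
    obtain x where x: "x \<in> ?F" "u = U x \<inter> f -` T" using \<open>u \<in> ?v\<close> by blast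
    obtain g where "homeomorphism (U x) (f ` U x) f g"
      using invariance_of_domain_homeomorphism[OF U(1)[OF x(1)] continuous_on_subset[OF cont subset_UNIV]
          order_refl U(3)[OF x(1)]] by blast
    moreover have "f ` u = T" using T_image[OF x(1)] x(2) by auto
    moreover note T_image[OF x(1)]
    ultimately show ?thesis
      using homeomorphism_of_subsets[of "U x" "f ` U x" f g u T] x(2) by blast
  qed
  moreover have "openin (top_of_set S) T"
    unfolding T_def using W by (simp add: openin_open_Int)
  ultimately show "\<exists>T. y \<in> T \<and> openin (top_of_set S) T \<and>
      (\<exists>v. \<Union>v = f -` S \<inter> f -` T \<and> (\<forall>u\<in>v. openin (top_of_set (f -` S)) u) \<and>
        pairwise disjnt v \<and> (\<forall>u\<in>v. \<exists>q. homeomorphism u T f q))"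
    using y_T by (intro exI[of _ T] conjI exI[of _ ?v]) auto
qed

section \<open>Fibres, local injectivity and properness of the maps\<close>

definition power_sum :: "'n::finite \<Rightarrow> ('n \<Rightarrow> nat) \<Rightarrow> complex ^ 'n \<Rightarrow> complex" where
  "power_sum l a x = (\<Sum>j\<in>UNIV - {l}. (x $ j) ^ a j)"

lemma power_sum_cong: "(\<And>i. i \<noteq> l \<Longrightarrow> x $ i = y $ i) \<Longrightarrow> power_sum l a x = power_sum l a y"
  unfolding power_sum_def by (rule sum.cong) auto

lemma f_map_nth:
  "f_map l d a x $ i =
    (if i = l then (x $ l) ^ d - of_nat d * power_sum l a x * x $ l else x $ i)"
  by (simp add: f_map_def power_sum_def)

lemma continuous_on_f_map: "continuous_on UNIV (f_map l d a)"
proof -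
  have "continuous_on UNIV (\<lambda>x. f_map l d a x $ i)" for i
    unfolding f_map_nth power_sum_def by (cases "i = l") (simp_all add: continuous_intros)
  then have "continuous_on UNIV (\<lambda>x. \<chi> i. f_map l d a x $ i)"
    by (rule continuous_on_vec_lambda)
  then show ?thesis by simp
qed

text \<open>Its roots are the possible values of coordinate \<open>l\<close> over \<open>y\<close>.
  The other coordinates of a preimage are those of \<open>y\<close>, which is why the power sum can
  be taken at \<open>y\<close>.\<close>

definition fibre_poly :: "'n::finite \<Rightarrow> nat \<Rightarrow> ('n \<Rightarrow> nat) \<Rightarrow> complex ^ 'n \<Rightarrow> complex poly" where
  "fibre_poly l d a y = monom 1 d + [:- (y $ l), - (of_nat d * power_sum l a y):]"

lemma poly_fibre_poly:
  "poly (fibre_poly l d a y) t = t ^ d - of_nat d * power_sum l a y * t - y $ l"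
  by (simp add: fibre_poly_def poly_monom algebra_simps)

lemma poly_pderiv_fibre_poly:
  "poly (pderiv (fibre_poly l d a y)) t = of_nat d * (t ^ (d - 1) - power_sum l a y)"
  by (simp add: fibre_poly_def poly_monom pderiv_add pderiv_monom pderiv_pCons algebra_simps)

lemma degree_fibre_poly:
  assumes "d \<ge> 2"
  shows "degree (fibre_poly l d a y) = d"
proof -
  have "degree [:- (y $ l), - (of_nat d * power_sum l a y):] < degree (monom (1::complex) d)"
    using assms by (simp add: degree_monom_eq)
  from degree_add_eq_left[OF this] show ?thesis
    unfolding fibre_poly_def by (simp add: degree_monom_eq)
qed

lemma fibre_f_map:
  "f_map l d a -` {y} =
    (\<lambda>t. \<chi> i. if i = l then t else y $ i) ` {t. poly (fibre_poly l d a y) t = 0}"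
proof (intro equalityI subsetI)
  fix x assume "x \<in> f_map l d a -` {y}"
  then have y: "y = f_map l d a x" by simp
  have x: "x = (\<chi> i. if i = l then x $ l else y $ i)"
    by (simp add: vec_eq_iff y f_map_nth)
  have "power_sum l a y = power_sum l a x"
    by (rule power_sum_cong) (simp add: y f_map_nth)
  then have "poly (fibre_poly l d a y) (x $ l) = 0"
    by (simp add: poly_fibre_poly) (simp add: y f_map_nth)
  then show "x \<in> (\<lambda>t. \<chi> i. if i = l then t else y $ i) ` {t. poly (fibre_poly l d a y) t = 0}"
    using x by blast
next
  fix x assume "x \<in> (\<lambda>t. \<chi> i. if i = l then t else y $ i) ` {t. poly (fibre_poly l d a y) t = 0}"
  then obtain t where t: "poly (fibre_poly l d a y) t = 0"
    and x: "x = (\<chi> i. if i = l then t else y $ i)" by blast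
  have "power_sum l a x = power_sum l a y"
    by (rule power_sum_cong) (simp add: x)
  then have "f_map l d a x = y"
    using t by (simp add: vec_eq_iff f_map_nth poly_fibre_poly) (simp add: x)
  then show "x \<in> f_map l d a -` {y}" by simp
qed

lemma card_fibre_f_map:
  "card (f_map l d a -` {y}) = card {t. poly (fibre_poly l d a y) t = 0}"
  unfolding fibre_f_map by (intro card_image inj_onI) (auto simp: vec_eq_iff split: if_splits)

lemma surj_f_map:
  assumes "d \<ge> 2"
  shows "surj (f_map l d a)"
proof -
  have "\<exists>x. f_map l d a x = y" for y
  proof -
    obtain t where "poly (fibre_poly l d a y) t = 0"
      using alg_closed_imp_poly_has_root[of "fibre_poly l d a y"] degree_fibre_poly[OF assms, of l a y]
        assms by auto
    then have "f_map l d a -` {y} \<noteq> {}" unfolding fibre_f_map by blast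
    then show ?thesis by auto
  qed
  then show ?thesis unfolding surj_def by metis
qed

text \<open>Points with equal images agree away from coordinate \<open>l\<close> and share the power
  sum. The difference of their last components is then \<open>z $ l - w $ l\<close> times a factor
  that is nonzero near the diagonal point.\<close>

lemma f_map_locally_injective:
  assumes "(x $ l) ^ (d - 1) \<noteq> power_sum l a x" "d > 0"
  shows "\<exists>U. open U \<and> x \<in> U \<and> inj_on (f_map l d a) U"
proof -
  \<comment> \<open>the difference quotient of the last coordinate, which on the diagonal is the Jacobian\<close>
  define F where "F z = (\<Sum>k<d. (snd z $ l) ^ (d - Suc k) * (fst z $ l) ^ k)
      - of_nat d * power_sum l a (fst z)" for z
  have "continuous_on UNIV F"
    unfolding F_def power_sum_def by (intro continuous_intros)
  then have "open {z. F z \<noteq> 0}"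
    by (intro open_Collect_neq continuous_on_const)
  moreover have "(\<Sum>k<d. (x $ l) ^ (d - Suc k) * (x $ l) ^ k) = of_nat d * (x $ l) ^ (d - 1)"
    by (simp flip: power_add)
  then have "F (x, x) = of_nat d * ((x $ l) ^ (d - 1) - power_sum l a x)"
    by (simp add: F_def right_diff_distrib)
  then have "(x, x) \<in> {z. F z \<noteq> 0}" using assms by simp
  ultimately obtain A B where AB: "open A" "open B" "(x, x) \<in> A \<times> B" "A \<times> B \<subseteq> {z. F z \<noteq> 0}"
    by (rule open_prod_elim)
  have "z = w" if "z \<in> A \<inter> B" "w \<in> A \<inter> B" and eq: "f_map l d a z = f_map l d a w" for z w
  proof -
    have "f_map l d a z $ i = f_map l d a w $ i" for i using eq by simp
    note nth = this[unfolded f_map_nth]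
    have z: "z $ i = w $ i" if "i \<noteq> l" for i using nth[of i] that by simp
    then have "power_sum l a z = power_sum l a w" by (rule power_sum_cong)
    then have "(z $ l) ^ d - (w $ l) ^ d = of_nat d * power_sum l a z * (z $ l - w $ l)"
      using nth[of l] by (simp add: algebra_simps)
    moreover have "(z $ l) ^ d - (w $ l) ^ d
        = (z $ l - w $ l) * (\<Sum>k<d. (w $ l) ^ (d - Suc k) * (z $ l) ^ k)"
      by (rule power_diff_sumr2)
    ultimately have "(z $ l - w $ l) * F (z, w) = 0"
      by (simp add: F_def algebra_simps)
    moreover have "F (z, w) \<noteq> 0" using AB(4) that by blast
    ultimately have "z $ l = w $ l" by simp
    with z show ?thesis by (metis vec_eq_iff)
  qed
  then show ?thesis
    using AB by (intro exI[of _ "A \<inter> B"]) (auto intro: inj_onI)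
qed

text \<open>On the preimage of \<open>K\<close> all coordinates except \<open>l\<close> are bounded
  directly, and so is the power sum. The last component then bounds coordinate \<open>l\<close>,
  because a power of degree at least 2 outgrows a linear term.\<close>

lemma compact_vimage_f_map:
  assumes "d \<ge> 2" "compact K"
  shows "compact (f_map l d a -` K)"
proof -
  have "closed (f_map l d a -` K)"
    using assms(2) continuous_on_f_map by (intro closed_vimage compact_imp_closed)
  moreover have "bounded (f_map l d a -` K)"
  proof -
    obtain R where R: "R > 0" "\<And>y. y \<in> K \<Longrightarrow> norm y \<le> R"
      using compact_imp_bounded[OF assms(2)] bounded_pos by metis
    define C where "C = (\<Sum>j\<in>UNIV - {l}. R ^ a j)"
    \<comment> \<open>Chosen so that \<open>t > M\<close> implies \<open>t > 1\<close> and
      \<open>t ^ d \<ge> t * t > M * t = t + R * t + real d * C * t\<close>, which exceeds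
      \<open>R + real d * C * t\<close>.\<close>
    define M where "M = 1 + R + real d * C"
    have C: "C \<ge> 0" using R by (auto simp: C_def intro: sum_nonneg)
    have "norm x \<le> (\<Sum>i\<in>(UNIV :: 'a set). M)" if "x \<in> f_map l d a -` K" for x
    proof -
      have nth: "norm (f_map l d a x $ i) \<le> R" for i
        using R(2)[of "f_map l d a x"] that Finite_Cartesian_Product.norm_nth_le[of "f_map l d a x" i] by auto
      have x_R: "norm (x $ i) \<le> R" if "i \<noteq> l" for i
        using nth[of i] that by (simp add: f_map_nth)
      have "norm (power_sum l a x) \<le> (\<Sum>j\<in>UNIV - {l}. norm (x $ j) ^ a j)"
        unfolding power_sum_def by (intro order_trans[OF norm_sum]) (simp add: norm_power)
      also have "\<dots> \<le> C"
        unfolding C_def using x_R by (intro sum_mono power_mono) auto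
      finally have S: "norm (power_sum l a x) \<le> C" .
      define t where "t = norm (x $ l)"
      have "t ^ d \<le> norm ((x $ l) ^ d - of_nat d * power_sum l a x * x $ l)
          + norm (of_nat d * power_sum l a x * x $ l)"
        unfolding t_def norm_power[symmetric]
        by (metis diff_add_cancel norm_triangle_ineq)
      also have "\<dots> \<le> R + real d * C * t"
        using nth[of l] S
        by (intro add_mono) (auto simp: f_map_nth norm_mult t_def intro!: mult_right_mono mult_left_mono)
      finally have le: "t ^ d \<le> R + real d * C * t" .
      have "t \<le> M"
      proof (rule ccontr)
        assume "\<not> t \<le> M"
        then have t: "t > M" by simp
        have dC: "real d * C \<ge> 0" using C by simp
        then have t1: "t > 1" using t R by (simp add: M_def)
        then have "t * t \<le> t ^ d" using assms(1) power_increasing[of 2 d t] by (simp add: power2_eq_square)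
        moreover have "M * t < t * t" using t t1 by simp
        moreover have "M * t = t + R * t + real d * C * t" by (simp add: M_def distrib_right)
        moreover have "R * 1 \<le> R * t" using R t1 by (intro mult_left_mono) auto
        ultimately show False using le t1 by linarith
      qed
      moreover have "R \<le> M" using C by (simp add: M_def)
      ultimately have "norm (x $ i) \<le> M" for i
        using x_R[of i] by (cases "i = l") (auto simp: t_def)
      moreover have "norm x \<le> (\<Sum>i\<in>UNIV. norm (x $ i))"
        unfolding norm_vec_def by (rule L2_set_le_sum) simp
      ultimately show ?thesis
        by (meson order_trans sum_mono)
    qed
    then show ?thesis by (metis boundedI)
  qed
  ultimately show ?thesis by (simp add: compact_eq_bounded_closed)
qed

lemma proper_polynomial_map_f_map:
  assumes "d \<ge> 2"
  shows "proper_polynomial_map (f_map l d a)"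
  unfolding proper_polynomial_map_def dominant_def
proof (intro conjI allI impI)
  fix p :: "complex ^ 'a \<Rightarrow> complex" and y
  assume p: "polynomial_fun p \<and> (\<forall>x. p (f_map l d a x) = 0)"
  obtain x where "y = f_map l d a x" using surj_f_map[OF assms] by (rule surjE)
  then show "p y = 0" using p by simp
qed (auto simp: polynomial_map_f_map compact_vimage_f_map assms)

section \<open>Branch locus and topological degree\<close>

lemma critical_locus_f_map:
  assumes "\<And>i. i \<noteq> l \<Longrightarrow> a i \<noteq> 0" "d > 0"
  shows "critical_locus (f_map l d a) = {x. (x $ l) ^ (d - 1) = power_sum l a x}"
  using jacobian_det_f_map[of l a d, OF assms(1)] assms(2)
  by (simp add: critical_locus_def power_sum_def)

lemma branch_locus_f_map_neq_UNIV:
  assumes "\<And>i. i \<noteq> l \<Longrightarrow> a i \<noteq> 0" "d \<ge> 2"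
  shows "branch_locus (f_map l d a) \<noteq> UNIV"
proof
  assume "branch_locus (f_map l d a) = UNIV"
  \<comment> \<open>A preimage of this point vanishes off \<open>l\<close>, so its power sum is 0.
    Being critical would force coordinate \<open>l\<close> to be 0 as well, and the image would be
    the origin.\<close>
  then have "axis l 1 \<in> branch_locus (f_map l d a)" by simp
  then obtain x where crit: "(x $ l) ^ (d - 1) = power_sum l a x" and x: "f_map l d a x = axis l 1"
    using critical_locus_f_map[of l a d, OF assms(1)] assms(2) unfolding branch_locus_def by force
  have nth: "f_map l d a x $ i = axis l 1 $ i" for i using x by simp
  have "x $ i = 0" if "i \<noteq> l" for i
    using nth[of i] that by (simp add: f_map_nth axis_def)
  then have "power_sum l a x = 0"
    using assms(1) unfolding power_sum_def by (intro sum.neutral) auto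
  then have "x $ l = 0" using crit by simp
  then show False using nth[of l] assms(2) by (simp add: f_map_nth power_0_left)
qed

lemma has_topological_degree_f_map:
  assumes a: "\<And>i. i \<noteq> l \<Longrightarrow> a i \<noteq> 0" and d: "d \<ge> 2"
  shows "has_topological_degree (f_map l d a) d"
proof -
  let ?f = "f_map l d a" and ?B = "branch_locus (f_map l d a)"
  have crit: "x \<in> critical_locus ?f \<longleftrightarrow> (x $ l) ^ (d - 1) = power_sum l a x" for x
    using critical_locus_f_map[of l a d, OF a] d by simp
  have fibre: "finite (?f -` {y}) \<and> card (?f -` {y}) = d" if y: "y \<notin> ?B" for y
  proof -
    let ?p = "fibre_poly l d a y"
    have deg: "degree ?p = d" by (rule degree_fibre_poly[OF d])
    then have p: "?p \<noteq> 0" using d by auto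
    \<comment> \<open>A multiple root would give a critical point over \<open>y\<close>, although
      \<open>y\<close> lies outside the branch locus.\<close>
    have "poly (pderiv ?p) t \<noteq> 0" if t: "poly ?p t = 0" for t
    proof
      assume "poly (pderiv ?p) t = 0"
      then have *: "t ^ (d - 1) = power_sum l a y" using d by (simp add: poly_pderiv_fibre_poly)
      define x where "x = (\<chi> i. if i = l then t else y $ i)"
      have "power_sum l a x = power_sum l a y" by (rule power_sum_cong) (simp add: x_def)
      then have "x \<in> critical_locus ?f" using * by (simp add: crit) (simp add: x_def)
      moreover have "x \<in> ?f -` {y}" unfolding fibre_f_map x_def using t by blast
      ultimately show False using y by (auto simp: branch_locus_def)
    qed
    from card_simple_roots[OF p this] deg show ?thesis
      using p by (simp add: card_fibre_f_map) (simp add: fibre_f_map poly_roots_finite)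
  qed
  have "covering_space (?f -` (- ?B)) ?f (- ?B)"
  proof (rule covering_space_locally_injective)
    fix x assume "?f x \<in> - ?B"
    then have "x \<notin> critical_locus ?f" by (auto simp: branch_locus_def)
    then show "\<exists>U. open U \<and> x \<in> U \<and> inj_on ?f U"
      using d by (intro f_map_locally_injective) (auto simp: crit)
  qed (use fibre d continuous_on_f_map in auto)
  moreover have "?B \<noteq> UNIV" by (rule branch_locus_f_map_neq_UNIV[OF a d])
  ultimately show ?thesis
    using fibre by (simp add: has_topological_degree_def vimage_Compl)
qed

section \<open>Infinitely many equivalence classes\<close>

lemma equivalent_maps_refl: "equivalent_maps f f"
proof -
  have "polynomial_map (id :: complex ^ 'a \<Rightarrow> complex ^ 'a)"
    by (simp add: polynomial_map_def polynomial_fun_coord)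
  then have "polynomial_automorphism (id :: complex ^ 'a \<Rightarrow> complex ^ 'a)"
    unfolding polynomial_automorphism_def by (metis comp_id)
  then show ?thesis unfolding equivalent_maps_def by (metis comp_id id_comp)
qed

lemma infinite_classes_f_map:
  fixes l :: "'n::finite"
  assumes "CARD('n) \<ge> 2" "d \<ge> 3"
  shows "infinite ({f :: complex ^ 'n \<Rightarrow> complex ^ 'n.
    proper_polynomial_map f \<and> has_topological_degree f d} // proper_equivalence)"
proof -
  \<comment> \<open>With all exponents equal to \<open>m + 2\<close> the invariant is
    \<open>(m + 1) ^ (CARD('n) - 1)\<close>, which is injective in \<open>m\<close> since the outer
    exponent is positive.\<close>
  define F where "F m = f_map l d (\<lambda>_. m + 2)" for m
  define C where "C m = proper_equivalence `` {F m}" for m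
  have proper: "proper_polynomial_map (F m)" for m
    using assms(2) by (simp add: F_def proper_polynomial_map_f_map)
  have "has_topological_degree (F m) d" for m
    unfolding F_def using assms(2) by (intro has_topological_degree_f_map) auto
  then have "range C \<subseteq> {f. proper_polynomial_map f \<and> has_topological_degree f d} // proper_equivalence"
    using proper by (auto simp: C_def intro: quotientI)
  moreover have "inj C"
  proof (rule injI)
    fix m k assume "C m = C k"
    moreover have "F k \<in> C k"
      using proper by (simp add: C_def proper_equivalence_def equivalent_maps_refl)
    ultimately have "equivalent_maps (F m) (F k)"
      by (auto simp: C_def proper_equivalence_def)
    then have "(\<Prod>i\<in>UNIV - {l}. m + 2 - 1) = (\<Prod>i\<in>UNIV - {l}. k + 2 - 1)"
      unfolding F_def by (intro equivalent_maps_prod_eq[OF assms(2)]) auto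
    then have "(m + 1) ^ (CARD('n) - 1) = (k + 1) ^ (CARD('n) - 1)"
      by (simp add: card_Diff_singleton)
    then have "m + 1 = k + 1"
      using assms(1) by (subst (asm) power_eq_iff_eq_base) auto
    then show "m = k" by simp
  qed
  then have "infinite (range C)" by (rule range_inj_infinite)
  ultimately show ?thesis by (metis finite_subset)
qed

theorem theoremD:
  fixes l :: "'n::finite" and d :: nat
  assumes "CARD('n) \<ge> 3" and "d \<ge> 3"
  shows "(\<forall>a :: 'n \<Rightarrow> nat. (\<forall>i. i \<noteq> l \<longrightarrow> a i \<ge> 2) \<longrightarrow> proper_polynomial_map (f_map l d a))
    \<and> (\<forall>a b :: 'n \<Rightarrow> nat.
         (\<forall>i. i \<noteq> l \<longrightarrow> a i \<ge> 2) \<and> (\<forall>i. i \<noteq> l \<longrightarrow> b i \<ge> 2) \<and>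
         (\<Prod>i\<in>UNIV - {l}. a i - 1) \<noteq> (\<Prod>i\<in>UNIV - {l}. b i - 1) \<longrightarrow>
         \<not> equivalent_maps (f_map l d a) (f_map l d b))
    \<and> infinite ({f :: complex ^ 'n \<Rightarrow> complex ^ 'n.
                   proper_polynomial_map f \<and> has_topological_degree f d} // proper_equivalence)"
proof (intro conjI allI impI)
  show "proper_polynomial_map (f_map l d a)" for a
    using assms(2) by (intro proper_polynomial_map_f_map) simp
next
  fix a b :: "'n \<Rightarrow> nat"
  assume ab: "(\<forall>i. i \<noteq> l \<longrightarrow> a i \<ge> 2) \<and> (\<forall>i. i \<noteq> l \<longrightarrow> b i \<ge> 2) \<and>
    (\<Prod>i\<in>UNIV - {l}. a i - 1) \<noteq> (\<Prod>i\<in>UNIV - {l}. b i - 1)"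
  then show "\<not> equivalent_maps (f_map l d a) (f_map l d b)"
    using equivalent_maps_prod_eq[OF assms(2), of l a b] by blast
next
  show "infinite ({f :: complex ^ 'n \<Rightarrow> complex ^ 'n.
      proper_polynomial_map f \<and> has_topological_degree f d} // proper_equivalence)"
    using assms by (intro infinite_classes_f_map) auto
qed

end
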